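(* Let $\mathcal{E}$ be an exact category. The pair $(\operatorname{eff}(\mathcal{E}),\mathcal{F})$ is a torsion pair in $\operatorname{mod}_{\mathsf{adm}}(\mathcal{E})$ such that $\operatorname{eff}(\mathcal{E})\subseteq\operatorname{mod}_{\mathsf{adm}}(\mathcal{E})$ satisfies the following axiom: every morphism $F\to G$ in $\operatorname{mod}_{\mathsf{adm}}(\mathcal{E})$ with $G\in\operatorname{eff}(\mathcal{E})$ is admissible with image in $\operatorname{eff}(\mathcal{E})$. In particular, $\operatorname{eff}(\mathcal{E})\subseteq\operatorname{mod}_{\mathsf{adm}}(\mathcal{E})$ is a percolating subcategory.
   Context: All categories are essentially small and additive; subcategories are full and closed under isomorphisms. Exact categories are in the sense of Quillen, with conflations, inflations and deflations; no idempotent completeness is assumed. A morphism is admissible if it is a composite $m\circ p$ with $p$ a deflation and $m$ an inflation; the middle object is its image. $\operatorname{Mod}(\mathcal{E})$ is the category of additive contravariant functors $\mathcal{E}\to\mathsf{Ab}$, $\Upsilon(X)=\operatorname{Hom}_{\mathcal{E}}(-,X)$. $\operatorname{mod}_{\mathsf{adm}}(\mathcal{E})$ (resp. $\operatorname{eff}(\mathcal{E})$, resp. $\mathcal{F}$) is the full subcategory of $\operatorname{Mod}(\mathcal{E})$ of functors $F$ with an exact sequence $\Upsilon(X)\xrightarrow{\Upsilon(f)}\Upsilon(Y)\to F\to0$ with $f$ an admissible morphism (resp. a deflation, resp. an inflation) in $\mathcal{E}$. $\operatorname{mod}_{\mathsf{adm}}(\mathcal{E})$ is extension-closed in $\operatorname{Mod}(\mathcal{E})$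 and carries the inherited exact structure. A torsion pair in an exact category is a pair $(\mathcal{T},\mathcal{F})$ of full isomorphism-closed subcategories with $\operatorname{Hom}(T,F)=0$ for $T\in\mathcal{T},F\in\mathcal{F}$ such that every object $M$ fits in a conflation $T\rightarrowtail M\twoheadrightarrow F$ with $T\in\mathcal{T},F\in\mathcal{F}$. A nonempty full subcategory $\mathcal{A}$ of an exact category $\mathcal{D}$ is percolating if: for every conflation $X\rightarrowtail Y\twoheadrightarrow Z$ in $\mathcal{D}$, $Y\in\mathcal{A}$ if and only if $X,Z\in\mathcal{A}$; every morphism $X\to A$ with $A\in\mathcal{A}$ is admissible with image in $\mathcal{A}$; and every morphism $A\to X$ with $A\in\mathcal{A}$ is admissible with image in $\mathcal{A}$. *)

theory Defs
  imports "HOL-Algebra.Coset"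
begin

section \<open>Additive and exact categories\<close>

text \<open>
  A small preadditive category together with a distinguished class of composable pairs.
  Hom-groups are commutative groups in the sense of HOL-Algebra, so the multiplicative
  notation of the library stands for the addition of morphisms and \<open>\<one>\<close> for the zero morphism.
  Hom-sets of different pairs of objects need not be disjoint, which is why composition
  takes the objects as arguments: \<open>Cmp D X Y Z g f\<close> is \<open>g \<circ> f\<close> for \<open>f : X \<rightarrow> Y\<close>, \<open>g : Y \<rightarrow> Z\<close>.
  \<open>Conf D X Y Z i p\<close> says that \<open>X \<rightarrow> Y \<rightarrow> Z\<close> (via \<open>i\<close>, \<open>p\<close>) is a conflation.
\<close>

record ('o, 'm) excat =
  Obj :: "'o set"
  Hom :: "'o \<Rightarrow> 'o \<Rightarrow> 'm monoid"
  Cmp :: "'o \<Rightarrow> 'o \<Rightarrow> 'o \<Rightarrow> 'm \<Rightarrow> 'm \<Rightarrow> 'm"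
  Idn :: "'o \<Rightarrow> 'm"
  Conf :: "'o \<Rightarrow> 'o \<Rightarrow> 'o \<Rightarrow> 'm \<Rightarrow> 'm \<Rightarrow> bool"

abbreviation Mor :: "('o, 'm) excat \<Rightarrow> 'o \<Rightarrow> 'o \<Rightarrow> 'm set" where
  "Mor D X Y \<equiv> carrier (Hom D X Y)"

abbreviation Zero :: "('o, 'm) excat \<Rightarrow> 'o \<Rightarrow> 'o \<Rightarrow> 'm" where
  "Zero D X Y \<equiv> \<one>\<^bsub>Hom D X Y\<^esub>"

locale preadditive_category =
  fixes D :: "('o, 'm) excat"
  assumes Hom_comm_group: "\<lbrakk>X \<in> Obj D; Y \<in> Obj D\<rbrakk> \<Longrightarrow> comm_group (Hom D X Y)"
    and Idn_Mor: "X \<in> Obj D \<Longrightarrow> Idn D X \<in> Mor D X X"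
    and Cmp_Mor: "\<lbrakk>X \<in> Obj D; Y \<in> Obj D; Z \<in> Obj D; f \<in> Mor D X Y; g \<in> Mor D Y Z\<rbrakk>
      \<Longrightarrow> Cmp D X Y Z g f \<in> Mor D X Z"
    and Cmp_assoc: "\<lbrakk>W \<in> Obj D; X \<in> Obj D; Y \<in> Obj D; Z \<in> Obj D;
        f \<in> Mor D W X; g \<in> Mor D X Y; h \<in> Mor D Y Z\<rbrakk>
      \<Longrightarrow> Cmp D W Y Z h (Cmp D W X Y g f) = Cmp D W X Z (Cmp D X Y Z h g) f"
    and Cmp_Idn: "\<lbrakk>X \<in> Obj D; Y \<in> Obj D; f \<in> Mor D X Y\<rbrakk> \<Longrightarrow> Cmp D X X Y f (Idn D X) = f"
    and Idn_Cmp: "\<lbrakk>X \<in> Obj D; Y \<in> Obj D; f \<in> Mor D X Y\<rbrakk> \<Longrightarrow> Cmp D X Y Y (Idn D Y) f = f"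
    and Cmp_add_right: "\<lbrakk>X \<in> Obj D; Y \<in> Obj D; Z \<in> Obj D;
        f \<in> Mor D X Y; f' \<in> Mor D X Y; g \<in> Mor D Y Z\<rbrakk>
      \<Longrightarrow> Cmp D X Y Z g (f \<otimes>\<^bsub>Hom D X Y\<^esub> f') =
          Cmp D X Y Z g f \<otimes>\<^bsub>Hom D X Z\<^esub> Cmp D X Y Z g f'"
    and Cmp_add_left: "\<lbrakk>X \<in> Obj D; Y \<in> Obj D; Z \<in> Obj D;
        f \<in> Mor D X Y; g \<in> Mor D Y Z; g' \<in> Mor D Y Z\<rbrakk>
      \<Longrightarrow> Cmp D X Y Z (g \<otimes>\<^bsub>Hom D Y Z\<^esub> g') f =
          Cmp D X Y Z g f \<otimes>\<^bsub>Hom D X Z\<^esub> Cmp D X Y Z g' f"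

definition zero_object :: "('o, 'm) excat \<Rightarrow> 'o \<Rightarrow> bool" where
  "zero_object D N \<longleftrightarrow> N \<in> Obj D \<and>
     (\<forall>X\<in>Obj D. Mor D X N = {Zero D X N} \<and> Mor D N X = {Zero D N X})"

definition biproduct ::
  "('o, 'm) excat \<Rightarrow> 'o \<Rightarrow> 'o \<Rightarrow> 'o \<Rightarrow> 'm \<Rightarrow> 'm \<Rightarrow> 'm \<Rightarrow> 'm \<Rightarrow> bool" where
  "biproduct D X Y S i j p q \<longleftrightarrow>
     X \<in> Obj D \<and> Y \<in> Obj D \<and> S \<in> Obj D \<and>
     i \<in> Mor D X S \<and> j \<in> Mor D Y S \<and> p \<in> Mor D S X \<and> q \<in> Mor D S Y \<and>
     Cmp D X S X p i = Idn D X \<and> Cmp D Y S Y q j = Idn D Y \<and>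
     Cmp D Y S X p j = Zero D Y X \<and> Cmp D X S Y q i = Zero D X Y \<and>
     Cmp D S X S i p \<otimes>\<^bsub>Hom D S S\<^esub> Cmp D S Y S j q = Idn D S"

locale additive_category = preadditive_category +
  assumes ex_zero_object: "\<exists>N. zero_object D N"
    and ex_biproduct: "\<lbrakk>X \<in> Obj D; Y \<in> Obj D\<rbrakk> \<Longrightarrow> \<exists>S i j p q. biproduct D X Y S i j p q"

definition is_iso :: "('o, 'm) excat \<Rightarrow> 'o \<Rightarrow> 'o \<Rightarrow> 'm \<Rightarrow> bool" where
  "is_iso D X Y f \<longleftrightarrow> f \<in> Mor D X Y \<and>
     (\<exists>g\<in>Mor D Y X. Cmp D X Y X g f = Idn D X \<and> Cmp D Y X Y f g = Idn D Y)"

definition is_kernel :: "('o, 'm) excat \<Rightarrow> 'o \<Rightarrow> 'o \<Rightarrow> 'o \<Rightarrow> 'm \<Rightarrow> 'm \<Rightarrow> bool" where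
  "is_kernel D X Y Z i p \<longleftrightarrow>
     i \<in> Mor D X Y \<and> p \<in> Mor D Y Z \<and> Cmp D X Y Z p i = Zero D X Z \<and>
     (\<forall>W\<in>Obj D. \<forall>g\<in>Mor D W Y. Cmp D W Y Z p g = Zero D W Z \<longrightarrow>
        (\<exists>!h. h \<in> Mor D W X \<and> Cmp D W X Y i h = g))"

definition is_cokernel :: "('o, 'm) excat \<Rightarrow> 'o \<Rightarrow> 'o \<Rightarrow> 'o \<Rightarrow> 'm \<Rightarrow> 'm \<Rightarrow> bool" where
  "is_cokernel D X Y Z i p \<longleftrightarrow>
     i \<in> Mor D X Y \<and> p \<in> Mor D Y Z \<and> Cmp D X Y Z p i = Zero D X Z \<and>
     (\<forall>W\<in>Obj D. \<forall>g\<in>Mor D Y W. Cmp D X Y W g i = Zero D X W \<longrightarrow>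
        (\<exists>!h. h \<in> Mor D Z W \<and> Cmp D Y Z W h p = g))"

text \<open>
  \<open>pullback D P A B C a b f g\<close>: the square with \<open>a : P \<rightarrow> A\<close>, \<open>b : P \<rightarrow> B\<close>,
  \<open>f : A \<rightarrow> C\<close>, \<open>g : B \<rightarrow> C\<close> is cartesian.
  \<open>pushout D C A B P f g a b\<close>: the square with \<open>f : C \<rightarrow> A\<close>, \<open>g : C \<rightarrow> B\<close>,
  \<open>a : A \<rightarrow> P\<close>, \<open>b : B \<rightarrow> P\<close> is cocartesian.
\<close>

definition pullback ::
  "('o, 'm) excat \<Rightarrow> 'o \<Rightarrow> 'o \<Rightarrow> 'o \<Rightarrow> 'o \<Rightarrow> 'm \<Rightarrow> 'm \<Rightarrow> 'm \<Rightarrow> 'm \<Rightarrow> bool" where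
  "pullback D P A B C a b f g \<longleftrightarrow>
     P \<in> Obj D \<and> A \<in> Obj D \<and> B \<in> Obj D \<and> C \<in> Obj D \<and>
     a \<in> Mor D P A \<and> b \<in> Mor D P B \<and> f \<in> Mor D A C \<and> g \<in> Mor D B C \<and>
     Cmp D P A C f a = Cmp D P B C g b \<and>
     (\<forall>W\<in>Obj D. \<forall>u\<in>Mor D W A. \<forall>v\<in>Mor D W B. Cmp D W A C f u = Cmp D W B C g v \<longrightarrow>
        (\<exists>!h. h \<in> Mor D W P \<and> Cmp D W P A a h = u \<and> Cmp D W P B b h = v))"

definition pushout ::
  "('o, 'm) excat \<Rightarrow> 'o \<Rightarrow> 'o \<Rightarrow> 'o \<Rightarrow> 'o \<Rightarrow> 'm \<Rightarrow> 'm \<Rightarrow> 'm \<Rightarrow> 'm \<Rightarrow> bool" where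
  "pushout D C A B P f g a b \<longleftrightarrow>
     C \<in> Obj D \<and> A \<in> Obj D \<and> B \<in> Obj D \<and> P \<in> Obj D \<and>
     f \<in> Mor D C A \<and> g \<in> Mor D C B \<and> a \<in> Mor D A P \<and> b \<in> Mor D B P \<and>
     Cmp D C A P a f = Cmp D C B P b g \<and>
     (\<forall>W\<in>Obj D. \<forall>u\<in>Mor D A W. \<forall>v\<in>Mor D B W. Cmp D C A W u f = Cmp D C B W v g \<longrightarrow>
        (\<exists>!h. h \<in> Mor D P W \<and> Cmp D A P W h a = u \<and> Cmp D B P W h b = v))"

definition inflation :: "('o, 'm) excat \<Rightarrow> 'o \<Rightarrow> 'o \<Rightarrow> 'm \<Rightarrow> bool" where
  "inflation D X Y i \<longleftrightarrow> (\<exists>Z p. Conf D X Y Z i p)"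

definition deflation :: "('o, 'm) excat \<Rightarrow> 'o \<Rightarrow> 'o \<Rightarrow> 'm \<Rightarrow> bool" where
  "deflation D Y Z p \<longleftrightarrow> (\<exists>X i. Conf D X Y Z i p)"

text \<open>Quillen's axioms in the self-dual form used by Buehler.\<close>

locale exact_category = additive_category +
  assumes Conf_Obj: "Conf D X Y Z i p \<Longrightarrow> X \<in> Obj D \<and> Y \<in> Obj D \<and> Z \<in> Obj D"
    and Conf_kernel: "Conf D X Y Z i p \<Longrightarrow> is_kernel D X Y Z i p"
    and Conf_cokernel: "Conf D X Y Z i p \<Longrightarrow> is_cokernel D X Y Z i p"
    and Conf_iso_closed:
      "\<lbrakk>Conf D X Y Z i p; X' \<in> Obj D; Y' \<in> Obj D; Z' \<in> Obj D;
        i' \<in> Mor D X' Y'; p' \<in> Mor D Y' Z';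
        is_iso D X X' a; is_iso D Y Y' b; is_iso D Z Z' c;
        Cmp D X Y Y' b i = Cmp D X X' Y' i' a;
        Cmp D Y Z Z' c p = Cmp D Y Y' Z' p' b\<rbrakk>
      \<Longrightarrow> Conf D X' Y' Z' i' p'"
    and inflation_Idn: "X \<in> Obj D \<Longrightarrow> inflation D X X (Idn D X)"
    and deflation_Idn: "X \<in> Obj D \<Longrightarrow> deflation D X X (Idn D X)"
    and inflation_Cmp: "\<lbrakk>inflation D X Y f; inflation D Y Z g\<rbrakk>
      \<Longrightarrow> inflation D X Z (Cmp D X Y Z g f)"
    and deflation_Cmp: "\<lbrakk>deflation D X Y f; deflation D Y Z g\<rbrakk>
      \<Longrightarrow> deflation D X Z (Cmp D X Y Z g f)"
    and inflation_pushout: "\<lbrakk>inflation D X Y i; X' \<in> Obj D; f \<in> Mor D X X'\<rbrakk>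
      \<Longrightarrow> \<exists>Y' f' i'. pushout D X Y X' Y' i f f' i' \<and> inflation D X' Y' i'"
    and deflation_pullback: "\<lbrakk>deflation D Y Z p; Z' \<in> Obj D; f \<in> Mor D Z' Z\<rbrakk>
      \<Longrightarrow> \<exists>Y' f' p'. pullback D Y' Y Z' Z f' p' p f \<and> deflation D Y' Z' p'"

definition admissible_with_image ::
  "('o, 'm) excat \<Rightarrow> 'o \<Rightarrow> 'o \<Rightarrow> 'o \<Rightarrow> 'm \<Rightarrow> bool" where
  "admissible_with_image D I X Y f \<longleftrightarrow>
     (\<exists>p m. deflation D X I p \<and> inflation D I Y m \<and> f = Cmp D X I Y m p)"

definition admissible :: "('o, 'm) excat \<Rightarrow> 'o \<Rightarrow> 'o \<Rightarrow> 'm \<Rightarrow> bool" where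
  "admissible D X Y f \<longleftrightarrow> (\<exists>I. admissible_with_image D I X Y f)"

section \<open>Subcategories, torsion pairs, percolating subcategories\<close>

text \<open>Full subcategories are identified with their classes of objects.\<close>

definition iso_closed_subcategory :: "('o, 'm) excat \<Rightarrow> 'o set \<Rightarrow> bool" where
  "iso_closed_subcategory D A \<longleftrightarrow> A \<subseteq> Obj D \<and>
     (\<forall>X\<in>A. \<forall>Y\<in>Obj D. (\<exists>f. is_iso D X Y f) \<longrightarrow> Y \<in> A)"

definition full_subcategory :: "('o, 'm) excat \<Rightarrow> 'o set \<Rightarrow> ('o, 'm) excat" where
  "full_subcategory D A = D\<lparr>Obj := A,
     Conf := (\<lambda>X Y Z i p. X \<in> A \<and> Y \<in> A \<and> Z \<in> A \<and> Conf D X Y Z i p)\<rparr>"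

definition torsion_pair :: "('o, 'm) excat \<Rightarrow> 'o set \<Rightarrow> 'o set \<Rightarrow> bool" where
  "torsion_pair D \<T> \<F> \<longleftrightarrow>
     iso_closed_subcategory D \<T> \<and> iso_closed_subcategory D \<F> \<and>
     (\<forall>T\<in>\<T>. \<forall>F\<in>\<F>. Mor D T F = {Zero D T F}) \<and>
     (\<forall>M\<in>Obj D. \<exists>T\<in>\<T>. \<exists>F\<in>\<F>. \<exists>i p. Conf D T M F i p)"

definition admissible_into :: "('o, 'm) excat \<Rightarrow> 'o set \<Rightarrow> bool" where
  "admissible_into D A \<longleftrightarrow>
     (\<forall>X\<in>Obj D. \<forall>Y\<in>A. \<forall>f\<in>Mor D X Y. \<exists>I\<in>A. admissible_with_image D I X Y f)"

definition admissible_out_of :: "('o, 'm) excat \<Rightarrow> 'o set \<Rightarrow> bool" where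
  "admissible_out_of D A \<longleftrightarrow>
     (\<forall>X\<in>A. \<forall>Y\<in>Obj D. \<forall>f\<in>Mor D X Y. \<exists>I\<in>A. admissible_with_image D I X Y f)"

definition percolating :: "('o, 'm) excat \<Rightarrow> 'o set \<Rightarrow> bool" where
  "percolating D A \<longleftrightarrow>
     iso_closed_subcategory D A \<and> A \<noteq> {} \<and>
     (\<forall>X Y Z i p. Conf D X Y Z i p \<longrightarrow> (Y \<in> A \<longleftrightarrow> X \<in> A \<and> Z \<in> A)) \<and>
     admissible_into D A \<and> admissible_out_of D A"

section \<open>Functor categories\<close>

text \<open>
  Contravariant functors to abelian groups with carrier in \<open>'u\<close>;
  \<open>act F X Y f : F Y \<rightarrow> F X\<close> is the action of \<open>f : X \<rightarrow> Y\<close>.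
\<close>

record ('o, 'm, 'u) presheaf =
  grp :: "'o \<Rightarrow> 'u monoid"
  act :: "'o \<Rightarrow> 'o \<Rightarrow> 'm \<Rightarrow> 'u \<Rightarrow> 'u"

definition additive_presheaf :: "('o, 'm) excat \<Rightarrow> ('o, 'm, 'u) presheaf \<Rightarrow> bool" where
  "additive_presheaf E F \<longleftrightarrow>
     (\<forall>X\<in>Obj E. comm_group (grp F X)) \<and>
     (\<forall>X\<in>Obj E. \<forall>Y\<in>Obj E. \<forall>f\<in>Mor E X Y. act F X Y f \<in> hom (grp F Y) (grp F X)) \<and>
     (\<forall>X\<in>Obj E. \<forall>x\<in>carrier (grp F X). act F X X (Idn E X) x = x) \<and>
     (\<forall>X\<in>Obj E. \<forall>Y\<in>Obj E. \<forall>Z\<in>Obj E. \<forall>f\<in>Mor E X Y. \<forall>g\<in>Mor E Y Z. \<forall>x\<in>carrier (grp F Z).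
        act F X Z (Cmp E X Y Z g f) x = act F X Y f (act F Y Z g x)) \<and>
     (\<forall>X\<in>Obj E. \<forall>Y\<in>Obj E. \<forall>f\<in>Mor E X Y. \<forall>g\<in>Mor E X Y. \<forall>x\<in>carrier (grp F Y).
        act F X Y (f \<otimes>\<^bsub>Hom E X Y\<^esub> g) x = act F X Y f x \<otimes>\<^bsub>grp F X\<^esub> act F X Y g x)"

text \<open>
  The components of a natural transformation are made \<open>undefined\<close> outside the objects of \<open>E\<close>
  and outside the carriers, so that equality of transformations is equality in HOL.
  The two functors may take values in groups over different types.
\<close>

definition nat_trans ::
  "('o, 'm) excat \<Rightarrow> ('o, 'm, 'u) presheaf \<Rightarrow> ('o, 'm, 'v) presheaf \<Rightarrow> ('o \<Rightarrow> 'u \<Rightarrow> 'v) set" where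
  "nat_trans E F G = {\<alpha> \<in> extensional (Obj E).
     (\<forall>X\<in>Obj E. \<alpha> X \<in> hom (grp F X) (grp G X) \<and> \<alpha> X \<in> extensional (carrier (grp F X))) \<and>
     (\<forall>X\<in>Obj E. \<forall>Y\<in>Obj E. \<forall>f\<in>Mor E X Y. \<forall>x\<in>carrier (grp F Y).
        \<alpha> X (act F X Y f x) = act G X Y f (\<alpha> Y x))}"

definition nat_trans_group ::
  "('o, 'm) excat \<Rightarrow> ('o, 'm, 'u) presheaf \<Rightarrow> ('o, 'm, 'v) presheaf \<Rightarrow> ('o \<Rightarrow> 'u \<Rightarrow> 'v) monoid" where
  "nat_trans_group E F G =
     \<lparr>carrier = nat_trans E F G,
      mult = (\<lambda>\<alpha> \<beta>. \<lambda>X\<in>Obj E. \<lambda>x\<in>carrier (grp F X). \<alpha> X x \<otimes>\<^bsub>grp G X\<^esub> \<beta> X x),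
      one = (\<lambda>X\<in>Obj E. \<lambda>x\<in>carrier (grp F X). \<one>\<^bsub>grp G X\<^esub>)\<rparr>"

text \<open>Exactness of sequences of functors is exactness at every object.\<close>

definition exact_at ::
  "('o, 'm) excat \<Rightarrow> ('o, 'm, 'u) presheaf \<Rightarrow> ('o, 'm, 'v) presheaf \<Rightarrow> ('o, 'm, 'w) presheaf \<Rightarrow>
   ('o \<Rightarrow> 'u \<Rightarrow> 'v) \<Rightarrow> ('o \<Rightarrow> 'v \<Rightarrow> 'w) \<Rightarrow> bool" where
  "exact_at E F G H \<alpha> \<beta> \<longleftrightarrow>
     (\<forall>X\<in>Obj E. \<alpha> X ` carrier (grp F X) = kernel (grp G X) (grp H X) (\<beta> X))"

definition pointwise_inj ::
  "('o, 'm) excat \<Rightarrow> ('o, 'm, 'u) presheaf \<Rightarrow> ('o \<Rightarrow> 'u \<Rightarrow> 'v) \<Rightarrow> bool" where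
  "pointwise_inj E F \<alpha> \<longleftrightarrow> (\<forall>X\<in>Obj E. inj_on (\<alpha> X) (carrier (grp F X)))"

definition pointwise_surj ::
  "('o, 'm) excat \<Rightarrow> ('o, 'm, 'u) presheaf \<Rightarrow> ('o, 'm, 'v) presheaf \<Rightarrow> ('o \<Rightarrow> 'u \<Rightarrow> 'v) \<Rightarrow> bool" where
  "pointwise_surj E F G \<alpha> \<longleftrightarrow> (\<forall>X\<in>Obj E. \<alpha> X ` carrier (grp F X) = carrier (grp G X))"

text \<open>The category of all additive presheaves with the short exact sequences as conflations.\<close>

definition Mod_cat :: "('o, 'm) excat \<Rightarrow> (('o, 'm, 'u) presheaf, 'o \<Rightarrow> 'u \<Rightarrow> 'u) excat" where
  "Mod_cat E =
     \<lparr>Obj = {F. additive_presheaf E F},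
      Hom = nat_trans_group E,
      Cmp = (\<lambda>F G H \<beta> \<alpha>. \<lambda>X\<in>Obj E. compose (carrier (grp F X)) (\<beta> X) (\<alpha> X)),
      Idn = (\<lambda>F. \<lambda>X\<in>Obj E. \<lambda>x\<in>carrier (grp F X). x),
      Conf = (\<lambda>F G H \<alpha> \<beta>.
        additive_presheaf E F \<and> additive_presheaf E G \<and> additive_presheaf E H \<and>
        \<alpha> \<in> nat_trans E F G \<and> \<beta> \<in> nat_trans E G H \<and>
        pointwise_inj E F \<alpha> \<and> exact_at E F G H \<alpha> \<beta> \<and> pointwise_surj E G H \<beta>)\<rparr>"

definition Yoneda :: "('o, 'm) excat \<Rightarrow> 'o \<Rightarrow> ('o, 'm, 'm) presheaf" where
  "Yoneda E Y = \<lparr>grp = (\<lambda>Z. Hom E Z Y), act = (\<lambda>W Z f g. Cmp E W Z Y g f)\<rparr>"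

definition Yoneda_mor :: "('o, 'm) excat \<Rightarrow> 'o \<Rightarrow> 'o \<Rightarrow> 'm \<Rightarrow> ('o \<Rightarrow> 'm \<Rightarrow> 'm)" where
  "Yoneda_mor E X Y f = (\<lambda>Z\<in>Obj E. \<lambda>g\<in>Mor E Z X. Cmp E Z X Y f g)"

text \<open>
  \<open>cokernel_of E X Y f F\<close>: there is an exact sequence
  \<open>Hom(-, X) \<rightarrow> Hom(-, Y) \<rightarrow> F \<rightarrow> 0\<close> whose first map is induced by \<open>f\<close>.
\<close>

definition cokernel_of ::
  "('o, 'm) excat \<Rightarrow> 'o \<Rightarrow> 'o \<Rightarrow> 'm \<Rightarrow> ('o, 'm, 'u) presheaf \<Rightarrow> bool" where
  "cokernel_of E X Y f F \<longleftrightarrow>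
     (\<exists>\<pi>\<in>nat_trans E (Yoneda E Y) F.
        exact_at E (Yoneda E X) (Yoneda E Y) F (Yoneda_mor E X Y f) \<pi> \<and>
        pointwise_surj E (Yoneda E Y) F \<pi>)"

definition adm_functors :: "('o, 'm) excat \<Rightarrow> ('o, 'm, 'u) presheaf set" where
  "adm_functors E = {F. additive_presheaf E F \<and>
     (\<exists>X Y f. admissible E X Y f \<and> cokernel_of E X Y f F)}"

definition eff :: "('o, 'm) excat \<Rightarrow> ('o, 'm, 'u) presheaf set" where
  "eff E = {F. additive_presheaf E F \<and>
     (\<exists>X Y f. deflation E X Y f \<and> cokernel_of E X Y f F)}"

definition inf_functors :: "('o, 'm) excat \<Rightarrow> ('o, 'm, 'u) presheaf set" where
  "inf_functors E = {F. additive_presheaf E F \<and>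
     (\<exists>X Y f. inflation E X Y f \<and> cokernel_of E X Y f F)}"

text \<open>
  The conflations of \<open>mod_adm E\<close> are the short exact sequences of functors whose three terms
  lie in \<open>adm_functors E\<close>. The value type \<open>'u\<close> is arbitrary and plays the role of the universe
  of abelian groups. When it is large enough for the Hom-groups of \<open>E\<close> to embed in it
  (for instance \<open>'u = 'm\<close>), then every cokernel of a map of representables is isomorphic
  to an object of \<open>Mod_cat E\<close>, and \<open>mod_adm E\<close> is the full category of admissibly presented functors.
\<close>

definition mod_adm :: "('o, 'm) excat \<Rightarrow> (('o, 'm, 'u) presheaf, 'o \<Rightarrow> 'u \<Rightarrow> 'u) excat" where
  "mod_adm E = full_subcategory (Mod_cat E) (adm_functors E)"

end

theory Submission
  imports Defs
begin

text \<open>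
  By Yoneda, a cokernel of \<open>\<Upsilon>(X) \<rightarrow> \<Upsilon>(Y)\<close> is a functor \<open>F\<close> generated by one element \<open>y \<in> F(Y)\<close>,
  and \<open>F(g)(y) = 0\<close> iff \<open>g\<close> factors through \<open>X \<rightarrow> Y\<close>. In this language an admissibly presented \<open>F\<close>
  lies in \<open>eff(E)\<close> iff every element is killed by \<open>F(q)\<close> for some deflation \<open>q\<close>, and in \<open>\<F>\<close> iff
  \<open>F(q)\<close> is injective for every deflation \<open>q\<close>. If \<open>F\<close> is presented by \<open>m \<circ> p\<close> with middle object
  \<open>I\<close>, the torsion part of \<open>F\<close> is generated by \<open>F(m)(y) \<in> F(I)\<close>: it is presented by \<open>p\<close>, and the
  quotient by \<open>m\<close>.

  Both admissibility axioms are one statement about a morphism \<open>\<alpha> : F \<rightarrow> G\<close> whose image consists of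
  elements killed by deflations. The image is generated by \<open>\<alpha>(y)\<close>, which lies in the torsion part of
  \<open>G\<close>, say \<open>\<alpha>(y) = G(m'g)(y')\<close>, where \<open>G\<close> is presented by \<open>m' \<circ> p'\<close>. Pulling \<open>p'\<close> back along \<open>g\<close>
  gives a deflation \<open>w\<close> presenting the image; the pullback of \<open>m \<circ> p\<close> along \<open>w\<close> presents the kernel,
  and \<open>m' \<circ> (g, p')\<close> presents the cokernel. All three are therefore admissibly presented.
\<close>

section \<open>Deflations and inflations\<close>

context exact_category
begin

lemmas Mor_closed [simp] = Cmp_Mor Idn_Mor

lemma Hom_group [simp]: "\<lbrakk>X \<in> Obj D; Y \<in> Obj D\<rbrakk> \<Longrightarrow> group (Hom D X Y)"
  using Hom_comm_group comm_group.axioms(2) by blast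

lemma Zero_Mor [simp]: "\<lbrakk>X \<in> Obj D; Y \<in> Obj D\<rbrakk> \<Longrightarrow> Zero D X Y \<in> Mor D X Y"
  by (simp add: group.is_monoid monoid.one_closed)

lemma inv_Mor [simp]:
  "\<lbrakk>X \<in> Obj D; Y \<in> Obj D; f \<in> Mor D X Y\<rbrakk> \<Longrightarrow> inv\<^bsub>Hom D X Y\<^esub> f \<in> Mor D X Y"
  by (simp add: group.inv_closed)

lemma add_Mor [simp]:
  "\<lbrakk>X \<in> Obj D; Y \<in> Obj D; f \<in> Mor D X Y; g \<in> Mor D X Y\<rbrakk> \<Longrightarrow> f \<otimes>\<^bsub>Hom D X Y\<^esub> g \<in> Mor D X Y"
  by (simp add: group.is_monoid monoid.m_closed)

lemma Cmp_left_group_hom: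
  assumes "X \<in> Obj D" "Y \<in> Obj D" "Z \<in> Obj D" "g \<in> Mor D Y Z"
  shows "group_hom (Hom D X Y) (Hom D X Z) (Cmp D X Y Z g)"
  using assms by (auto simp: group_hom_def group_hom_axioms_def hom_def Cmp_add_right)

lemma Cmp_right_group_hom:
  assumes "X \<in> Obj D" "Y \<in> Obj D" "Z \<in> Obj D" "f \<in> Mor D X Y"
  shows "group_hom (Hom D Y Z) (Hom D X Z) (\<lambda>g. Cmp D X Y Z g f)"
  using assms by (auto simp: group_hom_def group_hom_axioms_def hom_def Cmp_add_left)

lemma Cmp_Zero [simp]:
  "\<lbrakk>X \<in> Obj D; Y \<in> Obj D; Z \<in> Obj D; g \<in> Mor D Y Z\<rbrakk> \<Longrightarrow> Cmp D X Y Z g (Zero D X Y) = Zero D X Z"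
  using group_hom.hom_one[OF Cmp_left_group_hom] by blast

lemma Zero_Cmp [simp]:
  "\<lbrakk>X \<in> Obj D; Y \<in> Obj D; Z \<in> Obj D; f \<in> Mor D X Y\<rbrakk> \<Longrightarrow> Cmp D X Y Z (Zero D Y Z) f = Zero D X Z"
  using group_hom.hom_one[OF Cmp_right_group_hom] by blast

lemma inv_Cmp:
  "\<lbrakk>X \<in> Obj D; Y \<in> Obj D; Z \<in> Obj D; f \<in> Mor D X Y; g \<in> Mor D Y Z\<rbrakk>
    \<Longrightarrow> Cmp D X Y Z (inv\<^bsub>Hom D Y Z\<^esub> g) f = inv\<^bsub>Hom D X Z\<^esub> (Cmp D X Y Z g f)"
  using group_hom.hom_inv[OF Cmp_right_group_hom] by blast

lemma Conf_Mor:
  assumes "Conf D X Y Z i p"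
  shows "i \<in> Mor D X Y" "p \<in> Mor D Y Z" "Cmp D X Y Z p i = Zero D X Z"
  using Conf_kernel[OF assms] by (auto simp: is_kernel_def)

lemma deflationD:
  assumes "deflation D Y Z p"
  shows "Y \<in> Obj D" "Z \<in> Obj D" "p \<in> Mor D Y Z"
  using assms Conf_Obj Conf_Mor unfolding deflation_def by blast+

lemma inflationD:
  assumes "inflation D X Y i"
  shows "X \<in> Obj D" "Y \<in> Obj D" "i \<in> Mor D X Y"
  using assms Conf_Obj Conf_Mor unfolding inflation_def by blast+

lemma Conf_factors:
  assumes "Conf D X Y Z i p" "W \<in> Obj D" "g \<in> Mor D W Y" "Cmp D W Y Z p g = Zero D W Z"
  obtains h where "h \<in> Mor D W X" "Cmp D W X Y i h = g"
  using Conf_kernel[OF assms(1)] assms(2-) unfolding is_kernel_def by metis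

text \<open>Both maps are factorizations of one map through the kernel \<open>i\<close>, and the
  kernel property makes that factorization unique.\<close>

lemma inflation_mono:
  assumes "inflation D X Y i" "W \<in> Obj D" "g \<in> Mor D W X" "h \<in> Mor D W X"
    and "Cmp D W X Y i g = Cmp D W X Y i h"
  shows "g = h"
proof -
  obtain Z p where c: "Conf D X Y Z i p"
    using assms(1) by (auto simp: inflation_def)
  note objs = Conf_Obj[OF c] and mors = Conf_Mor[OF c]
  have "Cmp D W Y Z p (Cmp D W X Y i g) = Zero D W Z"
    using objs mors assms Cmp_assoc[of W X Y Z g i p] by simp
  moreover have "Cmp D W X Y i g \<in> Mor D W Y"
    using objs mors assms by simp
  ultimately have "\<exists>!k. k \<in> Mor D W X \<and> Cmp D W X Y i k = Cmp D W X Y i g"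
    using Conf_kernel[OF c] assms(2) unfolding is_kernel_def by blast
  thus ?thesis
    using assms by metis
qed

lemma deflation_epi:
  assumes "deflation D Y Z p" "W \<in> Obj D" "g \<in> Mor D Z W" "h \<in> Mor D Z W"
    and "Cmp D Y Z W g p = Cmp D Y Z W h p"
  shows "g = h"
proof -
  obtain X i where c: "Conf D X Y Z i p"
    using assms(1) by (auto simp: deflation_def)
  note objs = Conf_Obj[OF c] and mors = Conf_Mor[OF c]
  have "Cmp D X Y W (Cmp D Y Z W g p) i = Zero D X W"
    using objs mors assms Cmp_assoc[of X Y Z W i p g, symmetric] by simp
  moreover have "Cmp D Y Z W g p \<in> Mor D Y W"
    using objs mors assms by simp
  ultimately have "\<exists>!k. k \<in> Mor D Z W \<and> Cmp D Y Z W k p = Cmp D Y Z W g p"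
    using Conf_cokernel[OF c] assms(2) unfolding is_cokernel_def by blast
  thus ?thesis
    using assms by metis
qed

text \<open>The inflation \<open>m\<close> is the kernel of its cokernel \<open>c\<close>. The map
  \<open>c\<close> after \<open>g\<close> vanishes because it does so after the epimorphism
  \<open>q\<close>, hence \<open>g\<close> lifts to \<open>I\<close>. This orthogonality of
  deflations and inflations underlies the vanishing of Hom from torsion to torsion-free
  functors.\<close>

lemma factors_through_inflation:
  assumes m: "inflation D I Y m" and q: "deflation D W B q"
    and g: "g \<in> Mor D B Y" and l: "l \<in> Mor D W I" and eq: "Cmp D W B Y g q = Cmp D W I Y m l"
  obtains h where "h \<in> Mor D B I" "g = Cmp D B I Y m h"
proof -
  obtain C c where c: "Conf D I Y C m c"
    using m by (auto simp: inflation_def)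
  note objs = Conf_Obj[OF c] deflationD[OF q] and mors = Conf_Mor[OF c]
  have "Cmp D W B C (Cmp D B Y C c g) q = Cmp D W Y C c (Cmp D W I Y m l)"
    using objs mors g Cmp_assoc[of W B Y C q g c] eq by simp
  also have "\<dots> = Zero D W C"
    using objs mors l Cmp_assoc[of W I Y C l m c] by simp
  also have "\<dots> = Cmp D W B C (Zero D B C) q"
    using objs by simp
  finally have "Cmp D B Y C c g = Zero D B C"
    using deflation_epi[OF q, of C "Cmp D B Y C c g" "Zero D B C"] objs mors g by simp
  thus ?thesis
    using Conf_factors[OF c _ g] objs that by metis
qed

text \<open>The conflation ending in the identity of \<open>X\<close> is transported along
  identities on its first two terms and along \<open>f\<close> on the third.\<close>

lemma is_iso_deflation:
  assumes "X \<in> Obj D" "Y \<in> Obj D" "is_iso D X Y f"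
  shows "deflation D X Y f"
proof -
  obtain A i where c: "Conf D A X X i (Idn D X)"
    using deflation_Idn[OF assms(1)] by (auto simp: deflation_def)
  have id: "is_iso D B B (Idn D B)" if "B \<in> Obj D" for B
    using that by (auto simp: is_iso_def Cmp_Idn)
  have f: "f \<in> Mor D X Y"
    using assms by (simp add: is_iso_def)
  have "Conf D A X Y i f"
    using Conf_iso_closed[OF c _ _ _ _ _ id id assms(3)] Conf_Obj[OF c] Conf_Mor[OF c] f assms
    by (simp add: Cmp_Idn Idn_Cmp)
  thus ?thesis
    by (auto simp: deflation_def)
qed

text \<open>The identity factors through \<open>m\<close> because it does so after composing with the deflation \<open>q\<close>.\<close>

lemma inflation_is_iso:
  assumes m: "inflation D I Y m" and q: "deflation D W Y q"
    and l: "l \<in> Mor D W I" and eq: "q = Cmp D W I Y m l"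
  shows "is_iso D I Y m"
proof -
  note objs = inflationD[OF m] deflationD[OF q]
  obtain h where h: "h \<in> Mor D Y I" "Idn D Y = Cmp D Y I Y m h"
    using factors_through_inflation[OF m q _ l, of "Idn D Y"] objs eq by (auto simp: Idn_Cmp)
  have "Cmp D I I Y m (Cmp D I Y I h m) = Cmp D I I Y m (Idn D I)"
    using objs h Cmp_assoc[of I Y I Y m h m] by (simp add: Cmp_Idn Idn_Cmp flip: h(2))
  hence "Cmp D I Y I h m = Idn D I"
    using inflation_mono[OF m, of I] objs h by simp
  thus ?thesis
    using h objs by (auto simp: is_iso_def)
qed

section \<open>Pullbacks of deflations and the maps that factor through them\<close>

lemma pullbackD:
  assumes "pullback D P A B C a b f g"
  shows "P \<in> Obj D" "A \<in> Obj D" "B \<in> Obj D" "C \<in> Obj D"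
    and "a \<in> Mor D P A" "b \<in> Mor D P B" "f \<in> Mor D A C" "g \<in> Mor D B C"
    and "Cmp D P A C f a = Cmp D P B C g b"
  using assms by (auto simp: pullback_def)

lemma pullback_factors:
  assumes "pullback D P A B C a b f g" "W \<in> Obj D" "u \<in> Mor D W A" "v \<in> Mor D W B"
    and "Cmp D W A C f u = Cmp D W B C g v"
  obtains h where "h \<in> Mor D W P" "Cmp D W P A a h = u" "Cmp D W P B b h = v"
  using assms unfolding pullback_def by metis

text \<open>Keeps only the part of the pullback property that presentations see: which maps factor
  through \<open>w\<close>. It later identifies the maps that kill a restricted element.\<close>

lemma deflation_factor_pullback:
  assumes p: "deflation D Y Z p" and Z': "Z' \<in> Obj D" and f: "f \<in> Mor D Z' Z"
  obtains W w where "deflation D W Z' w"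
    "\<And>B h. \<lbrakk>B \<in> Obj D; h \<in> Mor D B Z'\<rbrakk> \<Longrightarrow>
      (\<exists>k\<in>Mor D B W. h = Cmp D B W Z' w k) \<longleftrightarrow> (\<exists>l\<in>Mor D B Y. Cmp D B Z' Z f h = Cmp D B Y Z p l)"
proof -
  obtain W u w where pb: "pullback D W Y Z' Z u w p f" and w: "deflation D W Z' w"
    using deflation_pullback[OF p Z' f] by blast
  note P = pullbackD[OF pb]
  have "(\<exists>k\<in>Mor D B W. h = Cmp D B W Z' w k) \<longleftrightarrow> (\<exists>l\<in>Mor D B Y. Cmp D B Z' Z f h = Cmp D B Y Z p l)"
    if B: "B \<in> Obj D" "h \<in> Mor D B Z'" for B h
  proof
    assume "\<exists>k\<in>Mor D B W. h = Cmp D B W Z' w k"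
    then obtain k where k: "k \<in> Mor D B W" "h = Cmp D B W Z' w k"
      by blast
    have "Cmp D B Z' Z f h = Cmp D B Y Z p (Cmp D B W Y u k)"
      using P B k Cmp_assoc[of B W Z' Z k w f] Cmp_assoc[of B W Y Z k u p] by simp
    thus "\<exists>l\<in>Mor D B Y. Cmp D B Z' Z f h = Cmp D B Y Z p l"
      using P B k Cmp_Mor by blast
  next
    assume "\<exists>l\<in>Mor D B Y. Cmp D B Z' Z f h = Cmp D B Y Z p l"
    thus "\<exists>k\<in>Mor D B W. h = Cmp D B W Z' w k"
      using pullback_factors[OF pb] B by metis
  qed
  thus ?thesis
    using that w by blast
qed

text \<open>The target is the cokernel of the identity of \<open>X\<close>, an inflation. There
  \<open>p\<close> equals its composite with the identity and so is zero; being epic as well, it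
  forces the identity of \<open>N\<close> to be zero.\<close>

lemma deflation_to_zero_object:
  assumes "X \<in> Obj D"
  obtains N p where "zero_object D N" "deflation D X N p"
proof -
  obtain N p where c: "Conf D X X N (Idn D X) p"
    using inflation_Idn[OF assms] by (auto simp: inflation_def)
  note objs = Conf_Obj[OF c] and mors = Conf_Mor[OF c]
  have p: "deflation D X N p"
    using c by (auto simp: deflation_def)
  have p0: "p = Zero D X N"
    using mors objs by (simp add: Cmp_Idn)
  have id0: "Idn D N = Zero D N N"
    using deflation_epi[OF p, of N "Idn D N" "Zero D N N"] objs p0 by simp
  have "g = Zero D Y N" if "Y \<in> Obj D" "g \<in> Mor D Y N" for Y g
    using Idn_Cmp[of Y N g] that objs id0 by simp
  moreover have "g = Zero D N Y" if "Y \<in> Obj D" "g \<in> Mor D N Y" for Y g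
    using Cmp_Idn[of N Y g] that objs id0 by simp
  ultimately have "zero_object D N"
    using objs unfolding zero_object_def by auto
  thus ?thesis
    using that p by blast
qed

text \<open>
  \<open>d\<close> is the map \<open>(g, f) : Y \<oplus> X \<rightarrow> Z\<close>. It is the pullback of \<open>f\<close> along \<open>Y \<oplus> Z \<rightarrow> Z\<close>, followed by a
  shear of \<open>Y \<oplus> Z\<close> and the projection to \<open>Z\<close>; the projection is a deflation as a pullback of \<open>Y \<rightarrow> 0\<close>.
\<close>

lemma deflation_sum:
  assumes f: "deflation D X Z f" and Y: "Y \<in> Obj D" and g: "g \<in> Mor D Y Z"
  obtains P d where "deflation D P Z d"
    "\<And>W h. \<lbrakk>W \<in> Obj D; h \<in> Mor D W Z\<rbrakk> \<Longrightarrow>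
      (\<exists>w\<in>Mor D W P. h = Cmp D W P Z d w) \<longleftrightarrow>
      (\<exists>k\<in>Mor D W Y. \<exists>l\<in>Mor D W X. h = Cmp D W Y Z g k \<otimes>\<^bsub>Hom D W Z\<^esub> Cmp D W X Z f l)"
proof -
  note fD [simp] = deflationD[OF f]
  obtain N n where N: "zero_object D N" and n: "deflation D Y N n"
    using deflation_to_zero_object[OF Y] .
  have NO [simp]: "N \<in> Obj D"
    using N by (simp add: zero_object_def)
  obtain Q a b where Q: "pullback D Q Y Z N a b n (Zero D Z N)" and b: "deflation D Q Z b"
    using deflation_pullback[OF n, of Z "Zero D Z N"] by auto
  note QD [simp] = pullbackD(1,5,6)[OF Q]
  \<comment> \<open>Parallel maps into \<open>N\<close> agree, so the pullback over \<open>N\<close>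
    has the universal property of the product of \<open>Y\<close> and \<open>Z\<close>;
    \<open>pair\<close> gives existence and \<open>pair_eq\<close> uniqueness.\<close>
  have into_N: "u = v" if "W \<in> Obj D" "u \<in> Mor D W N" "v \<in> Mor D W N" for W u v
    using N that unfolding zero_object_def by fastforce
  have pair: "\<exists>h. h \<in> Mor D W Q \<and> Cmp D W Q Y a h = u \<and> Cmp D W Q Z b h = v"
    if "W \<in> Obj D" "u \<in> Mor D W Y" "v \<in> Mor D W Z" for W u v
    using pullback_factors[OF Q that] into_N that deflationD[OF n] Y
    by (metis Cmp_Mor NO Zero_Mor fD(2))
  have pair_eq: "h = h'" if "W \<in> Obj D" "h \<in> Mor D W Q" "h' \<in> Mor D W Q"
      "Cmp D W Q Y a h = Cmp D W Q Y a h'" "Cmp D W Q Z b h = Cmp D W Q Z b h'" for W h h'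
  proof -
    have "Cmp D W Y N n (Cmp D W Q Y a h') = Cmp D W Z N (Zero D Z N) (Cmp D W Q Z b h')"
      using into_N[OF that(1)] that deflationD[OF n] by simp
    hence "\<exists>!k. k \<in> Mor D W Q \<and> Cmp D W Q Y a k = Cmp D W Q Y a h' \<and> Cmp D W Q Z b k = Cmp D W Q Z b h'"
      using Q that unfolding pullback_def by simp
    thus ?thesis
      using that by metis
  qed
  \<comment> \<open>\<open>u\<close> and \<open>u'\<close> are the second coordinates of the shear
    (y, z) to (y, g y + z) and of its inverse (y, z) to (y, z - g y). The maps \<open>s\<close> and
    \<open>t\<close> below are these shears.\<close>
  define u where "u = Cmp D Q Y Z g a \<otimes>\<^bsub>Hom D Q Z\<^esub> b"
  define u' where "u' = inv\<^bsub>Hom D Q Z\<^esub> (Cmp D Q Y Z g a) \<otimes>\<^bsub>Hom D Q Z\<^esub> b"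
  have uM [simp]: "u \<in> Mor D Q Z" "u' \<in> Mor D Q Z"
    using Y g by (simp_all add: u_def u'_def)
  obtain s where s [simp]: "s \<in> Mor D Q Q" and sa: "Cmp D Q Q Y a s = a" and sb: "Cmp D Q Q Z b s = u"
    using pair[of Q a u] by auto
  obtain t where t [simp]: "t \<in> Mor D Q Q" and ta: "Cmp D Q Q Y a t = a" and tb: "Cmp D Q Q Z b t = u'"
    using pair[of Q a u'] by auto
  interpret HQZ: comm_group "Hom D Q Z"
    by (simp add: Hom_comm_group)
  have us: "Cmp D Q Q Z u' s = b"
    using Y g sa sb Cmp_assoc[of Q Q Y Z s a g]
    by (simp add: u'_def u_def Cmp_add_left inv_Cmp HQZ.m_assoc[symmetric])
  have ut: "Cmp D Q Q Z u t = b"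
    using Y g ta tb Cmp_assoc[of Q Q Y Z t a g]
    by (simp add: u_def u'_def Cmp_add_left HQZ.m_assoc[symmetric])
  have "Cmp D Q Q Q t s = Idn D Q"
    by (rule pair_eq[of Q])
      (use Y sa ta sb tb us in \<open>simp_all add: Cmp_assoc[of Q Q Q _ s t] Cmp_Idn\<close>)
  moreover have "Cmp D Q Q Q s t = Idn D Q"
    by (rule pair_eq[of Q])
      (use Y sa ta sb tb ut in \<open>simp_all add: Cmp_assoc[of Q Q Q _ t s] Cmp_Idn\<close>)
  ultimately have "is_iso D Q Q s"
    by (auto simp: is_iso_def)
  hence ud: "deflation D Q Z u"
    using deflation_Cmp[OF is_iso_deflation b, of Q s] sb by simp
  obtain P x e where P: "pullback D P X Q Z x e f b" and e: "deflation D P Q e"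
    using deflation_pullback[OF f QD(1,3)] by blast
  note PD [simp] = pullbackD(1,5,6)[OF P]
  have d: "deflation D P Z (Cmp D P Q Z u e)"
    using deflation_Cmp[OF e ud] .
  \<comment> \<open>Composing \<open>u\<close> with \<open>e\<close> gives g a e + b e, and
    commutativity of the second pullback square replaces b e by f x.\<close>
  have dw: "Cmp D W P Z (Cmp D P Q Z u e) w =
      Cmp D W Y Z g (Cmp D W Q Y a (Cmp D W P Q e w)) \<otimes>\<^bsub>Hom D W Z\<^esub> Cmp D W X Z f (Cmp D W P X x w)"
    if "W \<in> Obj D" "w \<in> Mor D W P" for W w
    using that Y g pullbackD(9)[OF P]
    by (simp add: u_def Cmp_add_left Cmp_assoc[of W _ _ Z])
  show ?thesis
  proof (rule that[OF d], rule iffI)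
    fix W h assume W: "W \<in> Obj D" "h \<in> Mor D W Z"
    {
      assume "\<exists>w\<in>Mor D W P. h = Cmp D W P Z (Cmp D P Q Z u e) w"
      thus "\<exists>k\<in>Mor D W Y. \<exists>l\<in>Mor D W X. h = Cmp D W Y Z g k \<otimes>\<^bsub>Hom D W Z\<^esub> Cmp D W X Z f l"
        using dw W Y by (metis Cmp_Mor PD QD fD(1))
    next
      assume "\<exists>k\<in>Mor D W Y. \<exists>l\<in>Mor D W X. h = Cmp D W Y Z g k \<otimes>\<^bsub>Hom D W Z\<^esub> Cmp D W X Z f l"
      then obtain k l where kl: "k \<in> Mor D W Y" "l \<in> Mor D W X"
        "h = Cmp D W Y Z g k \<otimes>\<^bsub>Hom D W Z\<^esub> Cmp D W X Z f l"
        by blast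
      obtain q where q: "q \<in> Mor D W Q" "Cmp D W Q Y a q = k" "Cmp D W Q Z b q = Cmp D W X Z f l"
        using pair[of W k "Cmp D W X Z f l"] W kl by auto
      obtain w where w: "w \<in> Mor D W P" "Cmp D W P X x w = l" "Cmp D W P Q e w = q"
        using pullback_factors[OF P W(1) kl(2) q(1)] q(3) by metis
      show "\<exists>w\<in>Mor D W P. h = Cmp D W P Z (Cmp D P Q Z u e) w"
        using dw[OF W(1) w(1)] w(2,3) q(2) kl(3) by (intro bexI[OF _ w(1)]) simp
    }
  qed
qed

text \<open>The pullback of an admissible morphism along a deflation, built without forming it in
  one step. With \<open>c\<close> the cokernel of \<open>m\<close>, the composite of
  \<open>w\<close> and \<open>c\<close> is a deflation; its kernel \<open>j\<close> plays the role
  of the pullback of \<open>m\<close>. Then \<open>w\<close> restricts to \<open>w'\<close> from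
  \<open>J\<close> to \<open>I\<close>, and \<open>v\<close> is the pullback of \<open>p\<close>
  along \<open>w'\<close>.\<close>

lemma admissible_factor_pullback:
  assumes p: "deflation D X I p" and m: "inflation D I Y m" and w: "deflation D W Y w"
  obtains V J v j where "deflation D V J v" "inflation D J W j"
    "\<And>A h. \<lbrakk>A \<in> Obj D; h \<in> Mor D A W\<rbrakk> \<Longrightarrow>
      (\<exists>k\<in>Mor D A V. h = Cmp D A V W (Cmp D V J W j v) k) \<longleftrightarrow>
      (\<exists>l\<in>Mor D A X. Cmp D A W Y w h = Cmp D A X Y (Cmp D X I Y m p) l)"
proof -
  obtain C c where c: "Conf D I Y C m c"
    using m by (auto simp: inflation_def)
  note [simp] = deflationD[OF p] inflationD[OF m] deflationD[OF w] Conf_Obj[OF c] Conf_Mor[OF c]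
  have cd: "deflation D Y C c"
    using c by (auto simp: deflation_def)
  obtain J j where j: "Conf D J W C j (Cmp D W Y C c w)"
    using deflation_Cmp[OF w cd] by (auto simp: deflation_def)
  have ji: "inflation D J W j"
    using j by (auto simp: inflation_def)
  note [simp] = inflationD[OF ji]
  have "Cmp D J Y C c (Cmp D J W Y w j) = Zero D J C"
    using Conf_Mor[OF j] Cmp_assoc[of J W Y C j w c] by simp
  then obtain w' where w' [simp]: "w' \<in> Mor D J I" and mw': "Cmp D J I Y m w' = Cmp D J W Y w j"
    using Conf_factors[OF c, of J "Cmp D J W Y w j"] by auto
  obtain V v where v: "deflation D V J v" and vf: "\<And>B h. \<lbrakk>B \<in> Obj D; h \<in> Mor D B J\<rbrakk> \<Longrightarrow>
      (\<exists>k\<in>Mor D B V. h = Cmp D B V J v k) \<longleftrightarrow> (\<exists>l\<in>Mor D B X. Cmp D B J I w' h = Cmp D B X I p l)"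
    using deflation_factor_pullback[OF p _ w'] by auto
  note [simp] = deflationD[OF v]
  have wj: "Cmp D A W Y w (Cmp D A J W j u) = Cmp D A I Y m (Cmp D A J I w' u)"
    if "A \<in> Obj D" "u \<in> Mor D A J" for A u
    using that mw' Cmp_assoc[of A J W Y u j w] Cmp_assoc[of A J I Y u w' m] by simp
  show ?thesis
  proof (rule that[OF v ji])
    fix A h assume A [simp]: "A \<in> Obj D" "h \<in> Mor D A W"
    show "(\<exists>k\<in>Mor D A V. h = Cmp D A V W (Cmp D V J W j v) k) \<longleftrightarrow>
      (\<exists>l\<in>Mor D A X. Cmp D A W Y w h = Cmp D A X Y (Cmp D X I Y m p) l)"
    proof
      assume "\<exists>k\<in>Mor D A V. h = Cmp D A V W (Cmp D V J W j v) k"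
      then obtain k where k: "k \<in> Mor D A V" "h = Cmp D A J W j (Cmp D A V J v k)"
        using Cmp_assoc[of A V J W _ v j] by auto
      obtain l where "l \<in> Mor D A X" "Cmp D A J I w' (Cmp D A V J v k) = Cmp D A X I p l"
        using vf[of A "Cmp D A V J v k"] k by auto
      thus "\<exists>l\<in>Mor D A X. Cmp D A W Y w h = Cmp D A X Y (Cmp D X I Y m p) l"
        using k wj[of A "Cmp D A V J v k"] Cmp_assoc[of A X I Y l p m] by auto
    next
      assume "\<exists>l\<in>Mor D A X. Cmp D A W Y w h = Cmp D A X Y (Cmp D X I Y m p) l"
      then obtain l where l: "l \<in> Mor D A X" "Cmp D A W Y w h = Cmp D A I Y m (Cmp D A X I p l)"
        using Cmp_assoc[of A X I Y _ p m] by auto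
      \<comment> \<open>The factorization through \<open>m\<close> is killed by \<open>c\<close>, so
        \<open>h\<close> lifts to the kernel \<open>J\<close>; cancelling the monomorphism
        \<open>m\<close> then lets the lift pass through \<open>v\<close>.\<close>
      have "Cmp D A W C (Cmp D W Y C c w) h = Zero D A C"
        using l Cmp_assoc[of A W Y C h w c] Cmp_assoc[of A I Y C "Cmp D A X I p l" m c] by simp
      then obtain u where u: "u \<in> Mor D A J" "Cmp D A J W j u = h"
        using Conf_factors[OF j A] by blast
      have "Cmp D A J I w' u = Cmp D A X I p l"
        using inflation_mono[OF m, of A] wj[of A u] u l by simp
      then obtain k where "k \<in> Mor D A V" "u = Cmp D A V J v k"
        using vf[of A u] u l by auto
      thus "\<exists>k\<in>Mor D A V. h = Cmp D A V W (Cmp D V J W j v) k"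
        using u Cmp_assoc[of A V J W k v j] by auto
    qed
  qed
qed

end

section \<open>Subfunctors and quotient functors\<close>

text \<open>
  Quotient groups are modelled on coset representatives, so that quotients of functors with values
  in \<open>'u\<close> again take values in \<open>'u\<close>.
\<close>

definition coset_rep :: "('a, 'b) monoid_scheme \<Rightarrow> 'a set \<Rightarrow> 'a \<Rightarrow> 'a" where
  "coset_rep G H x = (SOME y. y \<in> H #>\<^bsub>G\<^esub> x)"

definition rep_quotient :: "('a, 'b) monoid_scheme \<Rightarrow> 'a set \<Rightarrow> 'a monoid" where
  "rep_quotient G H = \<lparr>carrier = coset_rep G H ` carrier G,
     mult = (\<lambda>x y. coset_rep G H (x \<otimes>\<^bsub>G\<^esub> y)), one = coset_rep G H \<one>\<^bsub>G\<^esub>\<rparr>"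

lemma rep_quotient_simps [simp]:
  "carrier (rep_quotient G H) = coset_rep G H ` carrier G"
  "x \<otimes>\<^bsub>rep_quotient G H\<^esub> y = coset_rep G H (x \<otimes>\<^bsub>G\<^esub> y)"
  "\<one>\<^bsub>rep_quotient G H\<^esub> = coset_rep G H \<one>\<^bsub>G\<^esub>"
  by (simp_all add: rep_quotient_def)

context
  fixes G :: "('a, 'b) monoid_scheme" (structure) and H :: "'a set"
  assumes G: "comm_group G" and H: "subgroup H G"
begin

interpretation comm_group G
  by (rule G)

lemma coset_rep_coset:
  assumes "x \<in> carrier G"
  shows "coset_rep G H x \<in> H #> x"
  using rcos_self[OF assms H] unfolding coset_rep_def by (rule someI)

lemma coset_rep_closed:
  assumes "x \<in> carrier G"
  shows "coset_rep G H x \<in> carrier G"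
  using coset_rep_coset[OF assms] r_coset_subset_G[OF subgroup.subset[OF H] assms] by blast

text \<open>The choice depends on \<open>x\<close> only through its coset and picks an element of
  that coset, so equal representatives mean equal cosets.\<close>

lemma coset_rep_eq_iff:
  assumes "x \<in> carrier G" "y \<in> carrier G"
  shows "coset_rep G H x = coset_rep G H y \<longleftrightarrow> x \<otimes> inv y \<in> H"
proof -
  have "x \<otimes> inv y \<in> H \<longleftrightarrow> x \<in> H #> y"
    using subgroup.rcos_module[OF H is_group assms(2,1)] by simp
  also have "\<dots> \<longleftrightarrow> H #> x = H #> y"
    using repr_independence[OF _ assms(2) H] rcos_self[OF assms(1) H] by metis
  also have "\<dots> \<longleftrightarrow> coset_rep G H x = coset_rep G H y"
    using repr_independence[OF coset_rep_coset _ H] assms unfolding coset_rep_def by metis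
  finally show ?thesis ..
qed

lemma coset_rep_one_iff:
  "x \<in> carrier G \<Longrightarrow> coset_rep G H x = coset_rep G H \<one> \<longleftrightarrow> x \<in> H"
  by (simp add: coset_rep_eq_iff)

lemma coset_rep_rep [simp]:
  "x \<in> carrier G \<Longrightarrow> coset_rep G H (coset_rep G H x) = coset_rep G H x"
  using repr_independence[OF coset_rep_coset _ H] unfolding coset_rep_def by metis

lemma coset_rep_diff:
  "x \<in> carrier G \<Longrightarrow> coset_rep G H x \<otimes> inv x \<in> H"
  using coset_rep_eq_iff coset_rep_closed coset_rep_rep by blast

text \<open>Well-definedness of the operation of \<open>rep_quotient\<close>: passing to a
  representative changes a product by an element of \<open>H\<close>. The second form follows from
  the first by commutativity.\<close>

lemma coset_rep_mult_cong:
  assumes "x \<in> carrier G" "y \<in> carrier G"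
  shows "coset_rep G H (coset_rep G H x \<otimes> y) = coset_rep G H (x \<otimes> y)"
    and "coset_rep G H (x \<otimes> coset_rep G H y) = coset_rep G H (x \<otimes> y)"
proof -
  have *: "coset_rep G H (coset_rep G H a \<otimes> b) = coset_rep G H (a \<otimes> b)"
    if [simp]: "a \<in> carrier G" "b \<in> carrier G" for a b
  proof -
    have [simp]: "coset_rep G H a \<in> carrier G"
      by (simp add: coset_rep_closed)
    have "(coset_rep G H a \<otimes> b) \<otimes> inv (a \<otimes> b) = coset_rep G H a \<otimes> inv a"
      by (simp add: inv_mult_group m_assoc) (simp flip: m_assoc)
    thus ?thesis
      using coset_rep_diff[OF that(1)] by (simp add: coset_rep_eq_iff)
  qed
  show "coset_rep G H (coset_rep G H x \<otimes> y) = coset_rep G H (x \<otimes> y)"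
    using * assms by blast
  show "coset_rep G H (x \<otimes> coset_rep G H y) = coset_rep G H (x \<otimes> y)"
    using *[OF assms(2,1)] assms coset_rep_closed by (simp add: m_comm)
qed

lemma rep_quotient_comm_group: "comm_group (rep_quotient G H)"
proof (rule comm_groupI)
  fix x assume "x \<in> carrier (rep_quotient G H)"
  then obtain a where a: "a \<in> carrier G" "x = coset_rep G H a"
    by auto
  show "\<exists>y\<in>carrier (rep_quotient G H). y \<otimes>\<^bsub>rep_quotient G H\<^esub> x = \<one>\<^bsub>rep_quotient G H\<^esub>"
    using a by (auto simp: coset_rep_mult_cong coset_rep_closed intro!: bexI[of _ "inv a"])
next
  fix x y z assume "x \<in> carrier (rep_quotient G H)" "y \<in> carrier (rep_quotient G H)"
    "z \<in> carrier (rep_quotient G H)"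
  thus "x \<otimes>\<^bsub>rep_quotient G H\<^esub> y \<otimes>\<^bsub>rep_quotient G H\<^esub> z =
      x \<otimes>\<^bsub>rep_quotient G H\<^esub> (y \<otimes>\<^bsub>rep_quotient G H\<^esub> z)"
    by (auto simp: coset_rep_mult_cong coset_rep_closed m_assoc)
qed (auto simp: coset_rep_mult_cong coset_rep_closed m_comm)

lemma coset_rep_group_hom: "coset_rep G H \<in> hom G (rep_quotient G H)"
  by (auto simp: hom_def coset_rep_mult_cong coset_rep_closed)

end

section \<open>Presentations by an element, effacement, and constructions on presheaves\<close>

definition presents ::
  "('o, 'm) excat \<Rightarrow> 'o \<Rightarrow> 'o \<Rightarrow> 'm \<Rightarrow> ('o, 'm, 'u) presheaf \<Rightarrow> 'u \<Rightarrow> bool" where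
  "presents E X Y f F y \<longleftrightarrow> y \<in> carrier (grp F Y) \<and>
     (\<forall>Z\<in>Obj E. \<forall>x\<in>carrier (grp F Z). \<exists>g\<in>Mor E Z Y. x = act F Z Y g y) \<and>
     (\<forall>Z\<in>Obj E. \<forall>g\<in>Mor E Z Y.
        act F Z Y g y = \<one>\<^bsub>grp F Z\<^esub> \<longleftrightarrow> (\<exists>h\<in>Mor E Z X. g = Cmp E Z X Y f h))"

text \<open>Local vanishing of an element for the topology whose covers are single
  deflations.\<close>

definition effaced :: "('o, 'm) excat \<Rightarrow> ('o, 'm, 'u) presheaf \<Rightarrow> 'o \<Rightarrow> 'u \<Rightarrow> bool" where
  "effaced E F Z x \<longleftrightarrow> (\<exists>W q. deflation E W Z q \<and> act F W Z q x = \<one>\<^bsub>grp F W\<^esub>)"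

definition subpresheaf :: "('o, 'm) excat \<Rightarrow> ('o, 'm, 'u) presheaf \<Rightarrow> ('o \<Rightarrow> 'u set) \<Rightarrow> bool" where
  "subpresheaf E F S \<longleftrightarrow> (\<forall>X\<in>Obj E. subgroup (S X) (grp F X)) \<and>
     (\<forall>X\<in>Obj E. \<forall>Y\<in>Obj E. \<forall>f\<in>Mor E X Y. \<forall>x\<in>S Y. act F X Y f x \<in> S X)"

definition restrict_presheaf ::
  "('o, 'm, 'u) presheaf \<Rightarrow> ('o \<Rightarrow> 'u set) \<Rightarrow> ('o, 'm, 'u) presheaf" where
  "restrict_presheaf F S = \<lparr>grp = (\<lambda>X. (grp F X)\<lparr>carrier := S X\<rparr>), act = act F\<rparr>"

text \<open>A representative is chosen again after acting, since \<open>act F\<close> need not send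
  chosen representatives to chosen ones.\<close>

definition quot_presheaf ::
  "('o, 'm, 'u) presheaf \<Rightarrow> ('o \<Rightarrow> 'u set) \<Rightarrow> ('o, 'm, 'u) presheaf" where
  "quot_presheaf F S = \<lparr>grp = (\<lambda>X. rep_quotient (grp F X) (S X)),
     act = (\<lambda>X Y f x. coset_rep (grp F X) (S X) (act F X Y f x))\<rparr>"

text \<open>The image of the transformation from the representable functor of \<open>Y\<close> that
  corresponds to \<open>y\<close> by Yoneda.\<close>

definition generated ::
  "('o, 'm) excat \<Rightarrow> ('o, 'm, 'u) presheaf \<Rightarrow> 'o \<Rightarrow> 'u \<Rightarrow> 'o \<Rightarrow> 'u set" where
  "generated E F Y y Z = (\<lambda>g. act F Z Y g y) ` Mor E Z Y"

lemma restrict_presheaf_simps [simp]: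
  "carrier (grp (restrict_presheaf F S) X) = S X"
  "\<one>\<^bsub>grp (restrict_presheaf F S) X\<^esub> = \<one>\<^bsub>grp F X\<^esub>"
  "x \<otimes>\<^bsub>grp (restrict_presheaf F S) X\<^esub> y = x \<otimes>\<^bsub>grp F X\<^esub> y"
  "act (restrict_presheaf F S) = act F"
  by (simp_all add: restrict_presheaf_def)

lemma quot_presheaf_simps [simp]:
  "grp (quot_presheaf F S) X = rep_quotient (grp F X) (S X)"
  "act (quot_presheaf F S) X Y f x = coset_rep (grp F X) (S X) (act F X Y f x)"
  by (simp_all add: quot_presheaf_def)

lemma nat_transD:
  assumes "\<alpha> \<in> nat_trans E F G" "X \<in> Obj E"
  shows "\<alpha> X \<in> hom (grp F X) (grp G X)"
    and "x \<in> carrier (grp F X) \<Longrightarrow> \<alpha> X x \<in> carrier (grp G X)"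
    and "\<lbrakk>Y \<in> Obj E; f \<in> Mor E X Y; y \<in> carrier (grp F Y)\<rbrakk>
      \<Longrightarrow> \<alpha> X (act F X Y f y) = act G X Y f (\<alpha> Y y)"
proof -
  show h: "\<alpha> X \<in> hom (grp F X) (grp G X)"
    using assms by (simp add: nat_trans_def)
  show "x \<in> carrier (grp F X) \<Longrightarrow> \<alpha> X x \<in> carrier (grp G X)"
    using h by (rule hom_in_carrier)
  show "\<lbrakk>Y \<in> Obj E; f \<in> Mor E X Y; y \<in> carrier (grp F Y)\<rbrakk>
      \<Longrightarrow> \<alpha> X (act F X Y f y) = act G X Y f (\<alpha> Y y)"
    using assms by (auto simp: nat_trans_def)
qed

section \<open>Additive presheaves and the Yoneda form of their presentations\<close>

locale additive_functor = exact_category +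
  fixes F :: "('a, 'b, 'u) presheaf"
  assumes presheaf: "additive_presheaf D F"
begin

lemma grp_comm_group: "X \<in> Obj D \<Longrightarrow> comm_group (grp F X)"
  using presheaf by (simp add: additive_presheaf_def)

lemma grp_group [simp]: "X \<in> Obj D \<Longrightarrow> group (grp F X)"
  using grp_comm_group comm_group.axioms(2) by blast

lemma act_hom:
  "\<lbrakk>X \<in> Obj D; Y \<in> Obj D; f \<in> Mor D X Y\<rbrakk> \<Longrightarrow> act F X Y f \<in> hom (grp F Y) (grp F X)"
  using presheaf by (simp add: additive_presheaf_def)

lemma act_group_hom:
  "\<lbrakk>X \<in> Obj D; Y \<in> Obj D; f \<in> Mor D X Y\<rbrakk> \<Longrightarrow> group_hom (grp F Y) (grp F X) (act F X Y f)"
  by (simp add: group_hom_def group_hom_axioms_def act_hom)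

lemma act_closed [simp]:
  "\<lbrakk>X \<in> Obj D; Y \<in> Obj D; f \<in> Mor D X Y; x \<in> carrier (grp F Y)\<rbrakk>
    \<Longrightarrow> act F X Y f x \<in> carrier (grp F X)"
  using act_hom hom_in_carrier by metis

lemma act_one [simp]:
  "\<lbrakk>X \<in> Obj D; Y \<in> Obj D; f \<in> Mor D X Y\<rbrakk> \<Longrightarrow> act F X Y f \<one>\<^bsub>grp F Y\<^esub> = \<one>\<^bsub>grp F X\<^esub>"
  using group_hom.hom_one[OF act_group_hom] .

lemma act_mult:
  "\<lbrakk>X \<in> Obj D; Y \<in> Obj D; f \<in> Mor D X Y; x \<in> carrier (grp F Y); y \<in> carrier (grp F Y)\<rbrakk>
    \<Longrightarrow> act F X Y f (x \<otimes>\<^bsub>grp F Y\<^esub> y) = act F X Y f x \<otimes>\<^bsub>grp F X\<^esub> act F X Y f y"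
  using group_hom.hom_mult[OF act_group_hom] .

lemma act_inv:
  "\<lbrakk>X \<in> Obj D; Y \<in> Obj D; f \<in> Mor D X Y; x \<in> carrier (grp F Y)\<rbrakk>
    \<Longrightarrow> act F X Y f (inv\<^bsub>grp F Y\<^esub> x) = inv\<^bsub>grp F X\<^esub> (act F X Y f x)"
  using group_hom.hom_inv[OF act_group_hom] .

lemma act_Idn [simp]:
  "\<lbrakk>X \<in> Obj D; x \<in> carrier (grp F X)\<rbrakk> \<Longrightarrow> act F X X (Idn D X) x = x"
  using presheaf by (simp add: additive_presheaf_def)

lemma act_Cmp:
  "\<lbrakk>X \<in> Obj D; Y \<in> Obj D; Z \<in> Obj D; f \<in> Mor D X Y; g \<in> Mor D Y Z; x \<in> carrier (grp F Z)\<rbrakk>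
    \<Longrightarrow> act F X Z (Cmp D X Y Z g f) x = act F X Y f (act F Y Z g x)"
  using presheaf by (simp add: additive_presheaf_def)

lemma act_add:
  "\<lbrakk>X \<in> Obj D; Y \<in> Obj D; f \<in> Mor D X Y; g \<in> Mor D X Y; x \<in> carrier (grp F Y)\<rbrakk>
    \<Longrightarrow> act F X Y (f \<otimes>\<^bsub>Hom D X Y\<^esub> g) x = act F X Y f x \<otimes>\<^bsub>grp F X\<^esub> act F X Y g x"
  using presheaf by (simp add: additive_presheaf_def)

lemma eval_group_hom:
  assumes "X \<in> Obj D" "Y \<in> Obj D" "y \<in> carrier (grp F Y)"
  shows "group_hom (Hom D X Y) (grp F X) (\<lambda>g. act F X Y g y)"
  using assms by (auto simp: group_hom_def group_hom_axioms_def hom_def act_add)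

lemma act_Zero [simp]:
  "\<lbrakk>X \<in> Obj D; Y \<in> Obj D; y \<in> carrier (grp F Y)\<rbrakk> \<Longrightarrow> act F X Y (Zero D X Y) y = \<one>\<^bsub>grp F X\<^esub>"
  using group_hom.hom_one[OF eval_group_hom] by blast

lemma inv_act:
  "\<lbrakk>X \<in> Obj D; Y \<in> Obj D; f \<in> Mor D X Y; x \<in> carrier (grp F Y)\<rbrakk>
    \<Longrightarrow> act F X Y (inv\<^bsub>Hom D X Y\<^esub> f) x = inv\<^bsub>grp F X\<^esub> (act F X Y f x)"
  using group_hom.hom_inv[OF eval_group_hom] by blast

text \<open>Yoneda: a transformation \<pi> from the representable functor of \<open>Y\<close> is
  determined by its value \<open>y\<close> on the identity, and naturality gives \<pi>(g) = F(g)(y).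
  Surjectivity of \<pi> becomes generation by \<open>y\<close>, and exactness describes the maps
  that kill \<open>y\<close>.\<close>

lemma cokernel_of_iff_presents:
  assumes [simp]: "X \<in> Obj D" "Y \<in> Obj D" "f \<in> Mor D X Y"
  shows "cokernel_of D X Y f F \<longleftrightarrow> (\<exists>y. presents D X Y f F y)"
proof
  assume "cokernel_of D X Y f F"
  then obtain \<pi> where \<pi>: "\<pi> \<in> nat_trans D (Yoneda D Y) F"
    and ex: "exact_at D (Yoneda D X) (Yoneda D Y) F (Yoneda_mor D X Y f) \<pi>"
    and surj: "pointwise_surj D (Yoneda D Y) F \<pi>"
    by (auto simp: cokernel_of_def)
  define y where "y = \<pi> Y (Idn D Y)"
  have y: "y \<in> carrier (grp F Y)"
    using nat_transD(2)[OF \<pi>, of Y "Idn D Y"] by (simp add: y_def Yoneda_def)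
  have \<pi>_eq: "\<pi> Z g = act F Z Y g y" if "Z \<in> Obj D" "g \<in> Mor D Z Y" for Z g
    using nat_transD(3)[OF \<pi>, of Z Y g "Idn D Y"] that by (simp add: y_def Yoneda_def Idn_Cmp)
  have "presents D X Y f F y"
    unfolding presents_def
  proof (intro conjI ballI y)
    fix Z x assume Z: "Z \<in> Obj D" "x \<in> carrier (grp F Z)"
    thus "\<exists>g\<in>Mor D Z Y. x = act F Z Y g y"
      using surj \<pi>_eq by (fastforce simp: pointwise_surj_def Yoneda_def)
  next
    fix Z g assume Z: "Z \<in> Obj D" "g \<in> Mor D Z Y"
    have eq: "(\<lambda>h\<in>Mor D Z X. Cmp D Z X Y f h) ` Mor D Z X = {g \<in> Mor D Z Y. \<pi> Z g = \<one>\<^bsub>grp F Z\<^esub>}"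
      using ex Z by (simp add: exact_at_def kernel_def Yoneda_def Yoneda_mor_def)
    have "(\<exists>h\<in>Mor D Z X. g = Cmp D Z X Y f h) \<longleftrightarrow>
        g \<in> (\<lambda>h\<in>Mor D Z X. Cmp D Z X Y f h) ` Mor D Z X"
      by (simp add: image_iff)
    hence "(\<exists>h\<in>Mor D Z X. g = Cmp D Z X Y f h) \<longleftrightarrow> \<pi> Z g = \<one>\<^bsub>grp F Z\<^esub>"
      unfolding eq using Z by simp
    thus "act F Z Y g y = \<one>\<^bsub>grp F Z\<^esub> \<longleftrightarrow> (\<exists>h\<in>Mor D Z X. g = Cmp D Z X Y f h)"
      using \<pi>_eq Z by simp
  qed
  thus "\<exists>y. presents D X Y f F y"
    by blast
next
  assume "\<exists>y. presents D X Y f F y"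
  then obtain y where y [simp]: "y \<in> carrier (grp F Y)"
    and gen: "\<And>Z x. \<lbrakk>Z \<in> Obj D; x \<in> carrier (grp F Z)\<rbrakk> \<Longrightarrow> \<exists>g\<in>Mor D Z Y. x = act F Z Y g y"
    and ann: "\<And>Z g. \<lbrakk>Z \<in> Obj D; g \<in> Mor D Z Y\<rbrakk>
      \<Longrightarrow> act F Z Y g y = \<one>\<^bsub>grp F Z\<^esub> \<longleftrightarrow> (\<exists>h\<in>Mor D Z X. g = Cmp D Z X Y f h)"
    by (auto simp: presents_def)
  define \<pi> where "\<pi> = (\<lambda>Z\<in>Obj D. \<lambda>g\<in>Mor D Z Y. act F Z Y g y)"
  have "\<pi> \<in> nat_trans D (Yoneda D Y) F"
    by (auto simp: \<pi>_def nat_trans_def Yoneda_def hom_def act_add act_Cmp)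
  moreover have "exact_at D (Yoneda D X) (Yoneda D Y) F (Yoneda_mor D X Y f) \<pi>"
    by (auto simp: \<pi>_def exact_at_def kernel_def Yoneda_def Yoneda_mor_def ann)
  moreover have "pointwise_surj D (Yoneda D Y) F \<pi>"
    using gen by (fastforce simp: \<pi>_def pointwise_surj_def Yoneda_def)
  ultimately show "cokernel_of D X Y f F"
    by (auto simp: cokernel_of_def)
qed

lemma presentsD:
  assumes "presents D X Y f F y"
  shows "y \<in> carrier (grp F Y)"
    and "\<lbrakk>Z \<in> Obj D; x \<in> carrier (grp F Z)\<rbrakk> \<Longrightarrow> \<exists>g\<in>Mor D Z Y. x = act F Z Y g y"
    and "\<lbrakk>Z \<in> Obj D; g \<in> Mor D Z Y\<rbrakk>
      \<Longrightarrow> act F Z Y g y = \<one>\<^bsub>grp F Z\<^esub> \<longleftrightarrow> (\<exists>h\<in>Mor D Z X. g = Cmp D Z X Y f h)"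
  using assms by (auto simp: presents_def)

lemma adm_functorsI:
  assumes p: "deflation D X I p" and m: "inflation D I Y m"
    and "presents D X Y (Cmp D X I Y m p) F y"
  shows "F \<in> adm_functors D"
proof -
  have "admissible D X Y (Cmp D X I Y m p)"
    using p m by (auto simp: admissible_def admissible_with_image_def)
  moreover have "cokernel_of D X Y (Cmp D X I Y m p) F"
    using assms deflationD[OF p] inflationD[OF m] by (subst cokernel_of_iff_presents) auto
  ultimately show ?thesis
    using presheaf unfolding adm_functors_def by blast
qed

lemma effI:
  assumes "deflation D X Y p" "presents D X Y p F y"
  shows "F \<in> eff D"
proof -
  have "cokernel_of D X Y p F"
    using assms(2) deflationD[OF assms(1)] by (subst cokernel_of_iff_presents) auto
  thus ?thesis
    using presheaf assms(1) unfolding eff_def by blast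
qed

lemma inf_functorsI:
  assumes "inflation D X Y m" "presents D X Y m F y"
  shows "F \<in> inf_functors D"
proof -
  have "cokernel_of D X Y m F"
    using assms(2) inflationD[OF assms(1)] by (subst cokernel_of_iff_presents) auto
  thus ?thesis
    using presheaf assms(1) unfolding inf_functors_def by blast
qed

section \<open>Subfunctors, quotients, and their induced presentations\<close>

lemma subpresheaf_subgroup:
  "\<lbrakk>subpresheaf D F S; X \<in> Obj D\<rbrakk> \<Longrightarrow> subgroup (S X) (grp F X)"
  by (simp add: subpresheaf_def)

lemma subpresheaf_carrier:
  "\<lbrakk>subpresheaf D F S; X \<in> Obj D; x \<in> S X\<rbrakk> \<Longrightarrow> x \<in> carrier (grp F X)"
  using subgroup.subset[OF subpresheaf_subgroup] by blast

text \<open>Well-definedness of the action on the quotient: a representative differs from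
  \<open>x\<close> by an element of \<open>S Y\<close>, which the action carries into
  \<open>S X\<close>.\<close>

lemma coset_rep_act:
  assumes S: "subpresheaf D F S"
    and [simp]: "X \<in> Obj D" "Y \<in> Obj D" "f \<in> Mor D X Y" "x \<in> carrier (grp F Y)"
  shows "coset_rep (grp F X) (S X) (act F X Y f (coset_rep (grp F Y) (S Y) x)) =
    coset_rep (grp F X) (S X) (act F X Y f x)"
proof -
  note cg = grp_comm_group and sub = subpresheaf_subgroup[OF S]
  have [simp]: "coset_rep (grp F Y) (S Y) x \<in> carrier (grp F Y)"
    by (simp add: coset_rep_closed[OF cg sub])
  have "act F X Y f (coset_rep (grp F Y) (S Y) x \<otimes>\<^bsub>grp F Y\<^esub> inv\<^bsub>grp F Y\<^esub> x) \<in> S X"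
    using S coset_rep_diff[OF cg sub, of Y x] by (simp add: subpresheaf_def)
  thus ?thesis
    by (simp add: coset_rep_eq_iff[OF cg sub] act_mult act_inv group.inv_closed)
qed

lemma additive_restrict_presheaf:
  assumes S: "subpresheaf D F S"
  shows "additive_presheaf D (restrict_presheaf F S)"
proof -
  note sub = subpresheaf_subgroup[OF S]
  note S_sub = subpresheaf_carrier[OF S]
  have "comm_group (grp (restrict_presheaf F S) X)" if "X \<in> Obj D" for X
  proof -
    have "comm_group ((grp F X)\<lparr>carrier := S X\<rparr>)"
    proof (rule group.group_comm_groupI)
      show "group ((grp F X)\<lparr>carrier := S X\<rparr>)"
        using group.subgroup_imp_group[OF grp_group sub] that by blast
      fix x y assume "x \<in> carrier ((grp F X)\<lparr>carrier := S X\<rparr>)" "y \<in> carrier ((grp F X)\<lparr>carrier := S X\<rparr>)"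
      thus "x \<otimes>\<^bsub>(grp F X)\<lparr>carrier := S X\<rparr>\<^esub> y = y \<otimes>\<^bsub>(grp F X)\<lparr>carrier := S X\<rparr>\<^esub> x"
        using comm_monoid.m_comm[OF comm_group.axioms(1)[OF grp_comm_group]] S_sub that by simp
    qed
    thus ?thesis
      by (simp add: restrict_presheaf_def)
  qed
  moreover have "act F X Y f \<in> hom (grp (restrict_presheaf F S) Y) (grp (restrict_presheaf F S) X)"
    if "X \<in> Obj D" "Y \<in> Obj D" "f \<in> Mor D X Y" for X Y f
    using that S S_sub by (auto simp: hom_def act_mult subpresheaf_def)
  ultimately show ?thesis
    unfolding additive_presheaf_def using S_sub by (simp add: act_Cmp act_add)
qed

lemma additive_quot_presheaf:
  assumes S: "subpresheaf D F S"
  shows "additive_presheaf D (quot_presheaf F S)"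
proof -
  note sub = subpresheaf_subgroup[OF S]
  note cg = grp_comm_group
  note act_rep = coset_rep_act[OF S]
  show ?thesis
    unfolding additive_presheaf_def
  proof (intro conjI ballI)
    fix X Y f assume [simp]: "X \<in> Obj D" "Y \<in> Obj D" "f \<in> Mor D X Y"
    interpret Y: comm_group "grp F Y"
      by (simp add: cg)
    show "act (quot_presheaf F S) X Y f \<in> hom (grp (quot_presheaf F S) Y) (grp (quot_presheaf F S) X)"
      by (auto simp: hom_def act_rep act_mult coset_rep_mult_cong[OF cg sub] coset_rep_closed[OF cg sub])
  next
    fix X assume "X \<in> Obj D"
    thus "comm_group (grp (quot_presheaf F S) X)"
      using rep_quotient_comm_group[OF cg sub] by simp
  next
    fix X x assume "X \<in> Obj D" "x \<in> carrier (grp (quot_presheaf F S) X)"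
    thus "act (quot_presheaf F S) X X (Idn D X) x = x"
      by (auto simp: act_rep coset_rep_rep[OF cg sub])
  next
    fix X Y Z f g x
    assume "X \<in> Obj D" "Y \<in> Obj D" "Z \<in> Obj D" "f \<in> Mor D X Y" "g \<in> Mor D Y Z"
      "x \<in> carrier (grp (quot_presheaf F S) Z)"
    thus "act (quot_presheaf F S) X Z (Cmp D X Y Z g f) x =
        act (quot_presheaf F S) X Y f (act (quot_presheaf F S) Y Z g x)"
      by (auto simp: act_rep act_Cmp)
  next
    fix X Y f g x
    assume "X \<in> Obj D" "Y \<in> Obj D" "f \<in> Mor D X Y" "g \<in> Mor D X Y"
      "x \<in> carrier (grp (quot_presheaf F S) Y)"
    thus "act (quot_presheaf F S) X Y (f \<otimes>\<^bsub>Hom D X Y\<^esub> g) x =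
        act (quot_presheaf F S) X Y f x \<otimes>\<^bsub>grp (quot_presheaf F S) X\<^esub> act (quot_presheaf F S) X Y g x"
      by (auto simp: act_rep)
        (simp add: act_add coset_rep_mult_cong[OF cg sub] coset_rep_closed[OF cg sub])
  qed
qed

text \<open>Supplies the torsion sequence of a functor, and the inflation of an image into its
  ambient functor.\<close>

lemma Conf_sub_quot:
  assumes S: "subpresheaf D F S"
  shows "Conf (Mod_cat D) (restrict_presheaf F S) F (quot_presheaf F S)
    (\<lambda>X\<in>Obj D. \<lambda>x\<in>S X. x)
    (\<lambda>X\<in>Obj D. \<lambda>x\<in>carrier (grp F X). coset_rep (grp F X) (S X) x)"
proof -
  note sub = subpresheaf_subgroup[OF S]
  note S_sub = subpresheaf_carrier[OF S]
  note cg = grp_comm_group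
  have incl: "(\<lambda>X\<in>Obj D. \<lambda>x\<in>S X. x) \<in> nat_trans D (restrict_presheaf F S) F"
    using S S_sub by (auto simp: nat_trans_def hom_def subpresheaf_def intro: subgroup.m_closed)
  note proj_act = coset_rep_act[OF S]
  have mult: "x \<otimes>\<^bsub>grp F X\<^esub> y \<in> carrier (grp F X)"
    if "X \<in> Obj D" "x \<in> carrier (grp F X)" "y \<in> carrier (grp F X)" for X x y
    using that by (simp add: group.is_monoid monoid.m_closed)
  have proj: "(\<lambda>X\<in>Obj D. \<lambda>x\<in>carrier (grp F X). coset_rep (grp F X) (S X) x)
      \<in> nat_trans D F (quot_presheaf F S)"
    using coset_rep_group_hom[OF cg sub]
    by (auto simp: nat_trans_def hom_def proj_act mult)
  have "exact_at D (restrict_presheaf F S) F (quot_presheaf F S) (\<lambda>X\<in>Obj D. \<lambda>x\<in>S X. x)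
      (\<lambda>X\<in>Obj D. \<lambda>x\<in>carrier (grp F X). coset_rep (grp F X) (S X) x)"
    using S_sub by (auto simp: exact_at_def kernel_def coset_rep_one_iff[OF cg sub])
  thus ?thesis
    using incl proj presheaf additive_restrict_presheaf[OF S] additive_quot_presheaf[OF S]
    by (simp add: Mod_cat_def pointwise_inj_def pointwise_surj_def inj_on_def)
qed

lemma generated_subpresheaf:
  assumes [simp]: "Y \<in> Obj D" "y \<in> carrier (grp F Y)"
  shows "subpresheaf D F (generated D F Y y)"
  unfolding subpresheaf_def
proof (intro conjI ballI)
  fix X assume X: "X \<in> Obj D"
  show "subgroup (generated D F Y y X) (grp F X)"
    unfolding generated_def
    using group_hom.img_is_subgroup[OF eval_group_hom[OF X assms]] .
next
  fix X Z f x assume "X \<in> Obj D" "Z \<in> Obj D" "f \<in> Mor D X Z" "x \<in> generated D F Y y Z"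
  thus "act F X Z f x \<in> generated D F Y y X"
    by (auto simp: generated_def act_Cmp[symmetric] intro!: imageI)
qed

text \<open>Generation holds by construction, with \<open>y\<close> itself obtained from the
  identity, so only the maps killing \<open>y\<close> have to be described.\<close>

lemma presents_generated:
  assumes "Y \<in> Obj D" "y \<in> carrier (grp F Y)"
    and "\<And>Z g. \<lbrakk>Z \<in> Obj D; g \<in> Mor D Z Y\<rbrakk>
      \<Longrightarrow> act F Z Y g y = \<one>\<^bsub>grp F Z\<^esub> \<longleftrightarrow> (\<exists>h\<in>Mor D Z X. g = Cmp D Z X Y f h)"
  shows "presents D X Y f (restrict_presheaf F (generated D F Y y)) y"
proof -
  have "y \<in> generated D F Y y Y"
    unfolding generated_def using assms by (intro image_eqI[of _ _ "Idn D Y"]) auto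
  thus ?thesis
    unfolding presents_def using assms(3) by (auto simp: generated_def)
qed

text \<open>A map \<open>h\<close> kills the class of \<open>y\<close> iff F(h)(y) = F(g k)(y) for
  some \<open>k\<close>, that is, iff h - g k factors through \<open>f\<close>. These are the maps
  that factor through (g, f) on the direct sum of \<open>B\<close> and \<open>X\<close>;
  \<open>d\<close> stands for any map with the same factorizations.\<close>

lemma presents_quot_generated:
  assumes pr: "presents D X Y f F y" and [simp]: "X \<in> Obj D" "Y \<in> Obj D" "B \<in> Obj D"
    and [simp]: "f \<in> Mor D X Y" "g \<in> Mor D B Y"
    and d: "\<And>Z h. \<lbrakk>Z \<in> Obj D; h \<in> Mor D Z Y\<rbrakk> \<Longrightarrow> (\<exists>w\<in>Mor D Z P. h = Cmp D Z P Y d w) \<longleftrightarrow>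
      (\<exists>k\<in>Mor D Z B. \<exists>l\<in>Mor D Z X. h = Cmp D Z B Y g k \<otimes>\<^bsub>Hom D Z Y\<^esub> Cmp D Z X Y f l)"
  defines "S \<equiv> generated D F B (act F B Y g y)"
  shows "presents D P Y d (quot_presheaf F S) (coset_rep (grp F Y) (S Y) y)"
proof -
  note [simp] = presentsD(1)[OF pr]
  have S: "subpresheaf D F S"
    unfolding S_def by (rule generated_subpresheaf) auto
  note sub = subpresheaf_subgroup[OF S]
  have act_rep: "coset_rep (grp F Z) (S Z) (act F Z Y h (coset_rep (grp F Y) (S Y) y)) =
      coset_rep (grp F Z) (S Z) (act F Z Y h y)" if "Z \<in> Obj D" "h \<in> Mor D Z Y" for Z h
    using coset_rep_act[OF S] that by simp
  have zero: "coset_rep (grp F Z) (S Z) (act F Z Y h y) = coset_rep (grp F Z) (S Z) \<one>\<^bsub>grp F Z\<^esub>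
      \<longleftrightarrow> (\<exists>w\<in>Mor D Z P. h = Cmp D Z P Y d w)"
    if Z [simp]: "Z \<in> Obj D" and h [simp]: "h \<in> Mor D Z Y" for Z h
  proof -
    interpret H: comm_group "Hom D Z Y"
      by (simp add: Hom_comm_group)
    interpret FZ: comm_group "grp F Z"
      by (simp add: grp_comm_group)
    \<comment> \<open>By additivity, two maps take the same value on \<open>y\<close> iff their
      difference kills \<open>y\<close>, and then the presentation applies.\<close>
    have ev: "act F Z Y h y = act F Z Y k y \<longleftrightarrow>
        (\<exists>l\<in>Mor D Z X. h = k \<otimes>\<^bsub>Hom D Z Y\<^esub> Cmp D Z X Y f l)" if k [simp]: "k \<in> Mor D Z Y" for k
    proof -
      have "act F Z Y h y = act F Z Y k y \<longleftrightarrow> act F Z Y (inv\<^bsub>Hom D Z Y\<^esub> k \<otimes>\<^bsub>Hom D Z Y\<^esub> h) y = \<one>\<^bsub>grp F Z\<^esub>"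
        using FZ.inv_solve_left'[of "\<one>\<^bsub>grp F Z\<^esub>" "act F Z Y k y" "act F Z Y h y"]
        by (auto simp: act_add inv_act)
      also have "\<dots> \<longleftrightarrow> (\<exists>l\<in>Mor D Z X. inv\<^bsub>Hom D Z Y\<^esub> k \<otimes>\<^bsub>Hom D Z Y\<^esub> h = Cmp D Z X Y f l)"
        by (rule presentsD(3)[OF pr]) auto
      also have "\<dots> \<longleftrightarrow> (\<exists>l\<in>Mor D Z X. h = k \<otimes>\<^bsub>Hom D Z Y\<^esub> Cmp D Z X Y f l)"
        by (intro bex_cong refl) (simp add: H.inv_solve_left')
      finally show ?thesis .
    qed
    have "coset_rep (grp F Z) (S Z) (act F Z Y h y) = coset_rep (grp F Z) (S Z) \<one>\<^bsub>grp F Z\<^esub>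
        \<longleftrightarrow> act F Z Y h y \<in> S Z"
      using coset_rep_one_iff[OF grp_comm_group sub] by simp
    also have "\<dots> \<longleftrightarrow> (\<exists>k\<in>Mor D Z B. act F Z Y h y = act F Z Y (Cmp D Z B Y g k) y)"
      unfolding S_def generated_def image_iff by (intro bex_cong refl) (simp add: act_Cmp)
    also have "\<dots> \<longleftrightarrow> (\<exists>k\<in>Mor D Z B. \<exists>l\<in>Mor D Z X.
        h = Cmp D Z B Y g k \<otimes>\<^bsub>Hom D Z Y\<^esub> Cmp D Z X Y f l)"
      by (intro bex_cong refl ev) simp
    finally show ?thesis
      using d[OF Z h] by simp
  qed
  show ?thesis
    unfolding presents_def
  proof (intro conjI ballI)
    fix Z x assume Z: "Z \<in> Obj D" "x \<in> carrier (grp (quot_presheaf F S) Z)"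
    then obtain a where a: "a \<in> carrier (grp F Z)" "x = coset_rep (grp F Z) (S Z) a"
      by auto
    obtain h where "h \<in> Mor D Z Y" "a = act F Z Y h y"
      using presentsD(2)[OF pr Z(1) a(1)] by blast
    thus "\<exists>h\<in>Mor D Z Y. x = act (quot_presheaf F S) Z Y h (coset_rep (grp F Y) (S Y) y)"
      using act_rep Z a by auto
  next
    fix Z h assume Z: "Z \<in> Obj D" "h \<in> Mor D Z Y"
    show "act (quot_presheaf F S) Z Y h (coset_rep (grp F Y) (S Y) y) = \<one>\<^bsub>grp (quot_presheaf F S) Z\<^esub>
        \<longleftrightarrow> (\<exists>w\<in>Mor D Z P. h = Cmp D Z P Y d w)"
      using zero[OF Z] act_rep[OF Z] by simp
  qed simp
qed

section \<open>Effaced elements and recognition of effaceable and torsion-free functors\<close>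

lemma adm_presentation:
  assumes "F \<in> adm_functors D"
  obtains X I Y p m y where "deflation D X I p" "inflation D I Y m"
    "presents D X Y (Cmp D X I Y m p) F y"
proof -
  obtain X I Y p m where p: "deflation D X I p" and m: "inflation D I Y m"
    and c: "cokernel_of D X Y (Cmp D X I Y m p) F"
    using assms by (auto simp: adm_functors_def admissible_def admissible_with_image_def)
  have "\<exists>y. presents D X Y (Cmp D X I Y m p) F y"
    using c deflationD[OF p] inflationD[OF m]
    by (subst cokernel_of_iff_presents[symmetric]) auto
  thus ?thesis
    using that p m by blast
qed

text \<open>The elements killed by some deflation are those of the subfunctor generated by \<open>F(m)(y)\<close>.\<close>

lemma effaced_factors:
  assumes p: "deflation D X I p" and m: "inflation D I Y m"
    and pr: "presents D X Y (Cmp D X I Y m p) F y"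
    and B [simp]: "B \<in> Obj D" and t: "t \<in> carrier (grp F B)" "effaced D F B t"
  obtains g where "g \<in> Mor D B I" "t = act F B Y (Cmp D B I Y m g) y"
proof -
  note [simp] = deflationD[OF p] inflationD[OF m] presentsD(1)[OF pr]
  obtain k where k [simp]: "k \<in> Mor D B Y" and tk: "t = act F B Y k y"
    using presentsD(2)[OF pr B t(1)] by blast
  obtain W q where q: "deflation D W B q" and tq: "act F W B q t = \<one>\<^bsub>grp F W\<^esub>"
    using t(2) by (auto simp: effaced_def)
  note [simp] = deflationD[OF q]
  have "act F W Y (Cmp D W B Y k q) y = \<one>\<^bsub>grp F W\<^esub>"
    using tq tk by (simp add: act_Cmp)
  then obtain l where "l \<in> Mor D W X" "Cmp D W B Y k q = Cmp D W X Y (Cmp D X I Y m p) l"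
    using presentsD(3)[OF pr, of W "Cmp D W B Y k q"] by auto
  hence "Cmp D W X I p l \<in> Mor D W I" "Cmp D W B Y k q = Cmp D W I Y m (Cmp D W X I p l)"
    using Cmp_assoc[of W X I Y l p m] by auto
  then obtain g where "g \<in> Mor D B I" "k = Cmp D B I Y m g"
    using factors_through_inflation[OF m q k] by blast
  thus ?thesis
    using that tk by blast
qed

text \<open>With t = F(m g)(y), a map \<open>h\<close> kills \<open>t\<close> iff m g h factors
  through m p, hence iff g h factors through \<open>p\<close>. The pullback \<open>w\<close> of
  \<open>p\<close> along \<open>g\<close> detects this. Consequently an effaced element generates an
  effaceable subfunctor.\<close>

lemma effaced_annihilator:
  assumes adm: "F \<in> adm_functors D" and B [simp]: "B \<in> Obj D"
    and t: "t \<in> carrier (grp F B)" "effaced D F B t"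
  obtains W w where "deflation D W B w"
    "\<And>A h. \<lbrakk>A \<in> Obj D; h \<in> Mor D A B\<rbrakk> \<Longrightarrow>
      act F A B h t = \<one>\<^bsub>grp F A\<^esub> \<longleftrightarrow> (\<exists>k\<in>Mor D A W. h = Cmp D A W B w k)"
proof -
  obtain X I Y p m y where p: "deflation D X I p" and m: "inflation D I Y m"
    and pr: "presents D X Y (Cmp D X I Y m p) F y"
    using adm_presentation[OF adm] .
  note [simp] = deflationD[OF p] inflationD[OF m] presentsD(1)[OF pr]
  obtain g where g [simp]: "g \<in> Mor D B I" and tg: "t = act F B Y (Cmp D B I Y m g) y"
    using effaced_factors[OF p m pr B t] .
  obtain W w where w: "deflation D W B w" and wf: "\<And>A h. \<lbrakk>A \<in> Obj D; h \<in> Mor D A B\<rbrakk> \<Longrightarrow>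
      (\<exists>k\<in>Mor D A W. h = Cmp D A W B w k) \<longleftrightarrow> (\<exists>l\<in>Mor D A X. Cmp D A B I g h = Cmp D A X I p l)"
    using deflation_factor_pullback[OF p B g] by blast
  show ?thesis
  proof (rule that[OF w])
    fix A h assume A [simp]: "A \<in> Obj D" "h \<in> Mor D A B"
    have "act F A B h t = act F A Y (Cmp D A I Y m (Cmp D A B I g h)) y"
      using tg by (simp add: act_Cmp)
    hence "act F A B h t = \<one>\<^bsub>grp F A\<^esub> \<longleftrightarrow>
        (\<exists>l\<in>Mor D A X. Cmp D A I Y m (Cmp D A B I g h) = Cmp D A X Y (Cmp D X I Y m p) l)"
      using presentsD(3)[OF pr, of A "Cmp D A I Y m (Cmp D A B I g h)"] by simp
    also have "\<dots> \<longleftrightarrow> (\<exists>l\<in>Mor D A X. Cmp D A B I g h = Cmp D A X I p l)"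
    proof (intro bex_cong refl)
      fix l assume "l \<in> Mor D A X"
      thus "Cmp D A I Y m (Cmp D A B I g h) = Cmp D A X Y (Cmp D X I Y m p) l \<longleftrightarrow>
          Cmp D A B I g h = Cmp D A X I p l"
        using inflation_mono[OF m, of A "Cmp D A B I g h" "Cmp D A X I p l"]
          Cmp_assoc[of A X I Y l p m] by auto
    qed
    finally show "act F A B h t = \<one>\<^bsub>grp F A\<^esub> \<longleftrightarrow> (\<exists>k\<in>Mor D A W. h = Cmp D A W B w k)"
      using wf[of A h] by simp
  qed
qed

text \<open>A deflation \<open>q\<close> that kills the generator \<open>y\<close> factors through m
  p, hence through \<open>m\<close>. This makes \<open>m\<close> an isomorphism, so the presenting
  map m p is already a deflation.\<close>

lemma effI_effaced:
  assumes adm: "F \<in> adm_functors D"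
    and eff: "\<And>Z x. \<lbrakk>Z \<in> Obj D; x \<in> carrier (grp F Z)\<rbrakk> \<Longrightarrow> effaced D F Z x"
  shows "F \<in> eff D"
proof -
  obtain X I Y p m y where p: "deflation D X I p" and m: "inflation D I Y m"
    and pr: "presents D X Y (Cmp D X I Y m p) F y"
    using adm_presentation[OF adm] .
  note [simp] = deflationD[OF p] inflationD[OF m] presentsD(1)[OF pr]
  obtain W q where q: "deflation D W Y q" and "act F W Y q y = \<one>\<^bsub>grp F W\<^esub>"
    using eff[of Y y] by (auto simp: effaced_def)
  moreover note [simp] = deflationD[OF q]
  ultimately obtain l where "l \<in> Mor D W X" "q = Cmp D W X Y (Cmp D X I Y m p) l"
    using presentsD(3)[OF pr, of W q] by auto
  hence "is_iso D I Y m"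
    using inflation_is_iso[OF m q, of "Cmp D W X I p l"] Cmp_assoc[of W X I Y l p m] by simp
  hence "deflation D X Y (Cmp D X I Y m p)"
    using deflation_Cmp[OF p is_iso_deflation] by simp
  thus ?thesis
    using pr by (rule effI)
qed

text \<open>The deflation \<open>p\<close> kills F(m)(y), so separatedness gives F(m)(y) = 0. The
  maps killing \<open>y\<close> are then those that factor through \<open>m\<close>, and
  \<open>m\<close> alone presents \<open>F\<close>.\<close>

lemma inf_functorsI_separated:
  assumes adm: "F \<in> adm_functors D"
    and sep: "\<And>W Z q x. \<lbrakk>deflation D W Z q; x \<in> carrier (grp F Z); act F W Z q x = \<one>\<^bsub>grp F W\<^esub>\<rbrakk>
      \<Longrightarrow> x = \<one>\<^bsub>grp F Z\<^esub>"
  shows "F \<in> inf_functors D"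
proof -
  obtain X I Y p m y where p: "deflation D X I p" and m: "inflation D I Y m"
    and pr: "presents D X Y (Cmp D X I Y m p) F y"
    using adm_presentation[OF adm] .
  note [simp] = deflationD[OF p] inflationD[OF m] presentsD(1)[OF pr]
  \<comment> \<open>The presenting map factors through itself by the identity, hence it kills
    \<open>y\<close>.\<close>
  have "\<exists>h\<in>Mor D X X. Cmp D X I Y m p = Cmp D X X Y (Cmp D X I Y m p) h"
    by (intro bexI[of _ "Idn D X"]) (simp_all add: Cmp_Idn)
  hence "act F X Y (Cmp D X I Y m p) y = \<one>\<^bsub>grp F X\<^esub>"
    using presentsD(3)[OF pr, of X "Cmp D X I Y m p"] by simp
  hence my: "act F I Y m y = \<one>\<^bsub>grp F I\<^esub>"
    using sep[OF p, of "act F I Y m y"] by (simp add: act_Cmp)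
  have "presents D I Y m F y"
    unfolding presents_def
  proof (intro conjI ballI iffI)
    fix Z x assume "Z \<in> Obj D" "x \<in> carrier (grp F Z)"
    thus "\<exists>g\<in>Mor D Z Y. x = act F Z Y g y"
      by (rule presentsD(2)[OF pr])
  next
    fix Z g assume Z: "Z \<in> Obj D" "g \<in> Mor D Z Y" "act F Z Y g y = \<one>\<^bsub>grp F Z\<^esub>"
    then obtain h where "h \<in> Mor D Z X" "g = Cmp D Z X Y (Cmp D X I Y m p) h"
      using presentsD(3)[OF pr] by blast
    thus "\<exists>h\<in>Mor D Z I. g = Cmp D Z I Y m h"
      using Z(1) Cmp_assoc[of Z X I Y h p m] by (intro bexI[of _ "Cmp D Z X I p h"]) simp_all
  next
    fix Z g assume "Z \<in> Obj D" "g \<in> Mor D Z Y" "\<exists>h\<in>Mor D Z I. g = Cmp D Z I Y m h"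
    thus "act F Z Y g y = \<one>\<^bsub>grp F Z\<^esub>"
      using my by (auto simp: act_Cmp)
  qed simp
  thus ?thesis
    using m by (intro inf_functorsI)
qed

end

section \<open>The category of admissibly presented functors\<close>

lemma mod_adm_simps [simp]:
  "Obj (mod_adm E) = adm_functors E"
  "Mor (mod_adm E) F G = nat_trans E F G"
  "Zero (mod_adm E) F G = (\<lambda>X\<in>Obj E. \<lambda>x\<in>carrier (grp F X). \<one>\<^bsub>grp G X\<^esub>)"
  "Cmp (mod_adm E) F G H \<beta> \<alpha> = (\<lambda>X\<in>Obj E. compose (carrier (grp F X)) (\<beta> X) (\<alpha> X))"
  "Idn (mod_adm E) F = (\<lambda>X\<in>Obj E. \<lambda>x\<in>carrier (grp F X). x)"
  "Conf (mod_adm E) F G H \<alpha> \<beta> \<longleftrightarrow> F \<in> adm_functors E \<and> G \<in> adm_functors E \<and> H \<in> adm_functors E \<and>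
     Conf (Mod_cat E) F G H \<alpha> \<beta>"
  by (auto simp: mod_adm_def full_subcategory_def Mod_cat_def nat_trans_group_def)

lemma nat_trans_eqI:
  assumes \<alpha>: "\<alpha> \<in> nat_trans E F G" and \<beta>: "\<beta> \<in> nat_trans E F G"
    and eq: "\<And>X x. \<lbrakk>X \<in> Obj E; x \<in> carrier (grp F X)\<rbrakk> \<Longrightarrow> \<alpha> X x = \<beta> X x"
  shows "\<alpha> = \<beta>"
proof (rule extensionalityI[of _ "Obj E"])
  fix X assume X: "X \<in> Obj E"
  show "\<alpha> X = \<beta> X"
    by (rule extensionalityI[of _ "carrier (grp F X)"]) (use \<alpha> \<beta> eq X in \<open>auto simp: nat_trans_def\<close>)
qed (use \<alpha> \<beta> in \<open>auto simp: nat_trans_def\<close>)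

context exact_category
begin

section \<open>Effaceable functors as torsion, functors presented by inflations as
  torsion-free\<close>

lemma adm_additive_functor: "F \<in> adm_functors D \<Longrightarrow> additive_functor D F"
  by unfold_locales (simp add: adm_functors_def)

lemma eff_presentation:
  assumes "F \<in> eff D"
  obtains X Y p y where "deflation D X Y p" "presents D X Y p F y"
proof -
  interpret additive_functor D F
    by unfold_locales (use assms in \<open>simp add: eff_def\<close>)
  obtain X Y p where p: "deflation D X Y p" and "cokernel_of D X Y p F"
    using assms by (auto simp: eff_def)
  thus ?thesis
    using that cokernel_of_iff_presents[OF deflationD[OF p]] by blast
qed

lemma inf_presentation:
  assumes "F \<in> inf_functors D"
  obtains X Y m y where "inflation D X Y m" "presents D X Y m F y"
proof -
  interpret additive_functor D F
    by unfold_locales (use assms in \<open>simp add: inf_functors_def\<close>)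
  obtain X Y m where m: "inflation D X Y m" and "cokernel_of D X Y m F"
    using assms by (auto simp: inf_functors_def)
  thus ?thesis
    using that cokernel_of_iff_presents[OF inflationD[OF m]] by blast
qed

lemma eff_adm:
  assumes "F \<in> eff D"
  shows "F \<in> adm_functors D"
proof -
  interpret additive_functor D F
    by unfold_locales (use assms in \<open>simp add: eff_def\<close>)
  obtain X Y p y where p: "deflation D X Y p" and pr: "presents D X Y p F y"
    using eff_presentation[OF assms] .
  show ?thesis
    using adm_functorsI[OF p inflation_Idn, of y] pr deflationD[OF p] by (simp add: Idn_Cmp)
qed

lemma inf_adm:
  assumes "F \<in> inf_functors D"
  shows "F \<in> adm_functors D"
proof -
  interpret additive_functor D F
    by unfold_locales (use assms in \<open>simp add: inf_functors_def\<close>)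
  obtain X Y m y where m: "inflation D X Y m" and pr: "presents D X Y m F y"
    using inf_presentation[OF assms] .
  show ?thesis
    using adm_functorsI[OF deflation_Idn m, of y] pr inflationD[OF m] by (simp add: Cmp_Idn)
qed

text \<open>Write x = F(g)(y). The pullback \<open>w\<close> of \<open>p\<close> along
  \<open>g\<close> is a deflation, and g w factors through \<open>p\<close>, so \<open>w\<close>
  kills \<open>x\<close>.\<close>

lemma eff_effaced:
  assumes F: "F \<in> eff D" and Z [simp]: "Z \<in> Obj D" and x: "x \<in> carrier (grp F Z)"
  shows "effaced D F Z x"
proof -
  interpret additive_functor D F
    by (rule adm_additive_functor[OF eff_adm[OF F]])
  obtain X Y p y where p: "deflation D X Y p" and pr: "presents D X Y p F y"
    using eff_presentation[OF F] .
  note [simp] = deflationD[OF p] presentsD(1)[OF pr]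
  obtain g where g [simp]: "g \<in> Mor D Z Y" and xg: "x = act F Z Y g y"
    using presentsD(2)[OF pr Z x] by blast
  obtain W u w where pb: "pullback D W X Z Y u w p g" and w: "deflation D W Z w"
    using deflation_pullback[OF p Z g] by blast
  note [simp] = deflationD[OF w]
  have "act F W Y (Cmp D W Z Y g w) y = \<one>\<^bsub>grp F W\<^esub>"
    using presentsD(3)[OF pr, of W "Cmp D W Z Y g w"] pullbackD[OF pb] by (auto intro: bexI[of _ u])
  thus ?thesis
    using w xg by (auto simp: effaced_def act_Cmp)
qed

text \<open>Write x = F(g)(y). If \<open>q\<close> kills \<open>x\<close>, then g q factors through
  the inflation \<open>m\<close>, and therefore so does \<open>g\<close>.\<close>

lemma inf_separated:
  assumes F: "F \<in> inf_functors D" and q: "deflation D W Z q"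
    and x: "x \<in> carrier (grp F Z)" "act F W Z q x = \<one>\<^bsub>grp F W\<^esub>"
  shows "x = \<one>\<^bsub>grp F Z\<^esub>"
proof -
  interpret additive_functor D F
    by (rule adm_additive_functor[OF inf_adm[OF F]])
  obtain X Y m y where m: "inflation D X Y m" and pr: "presents D X Y m F y"
    using inf_presentation[OF F] .
  note [simp] = inflationD[OF m] deflationD[OF q] presentsD(1)[OF pr]
  obtain g where g [simp]: "g \<in> Mor D Z Y" and xg: "x = act F Z Y g y"
    using presentsD(2)[OF pr _ x(1)] by auto
  have "act F W Y (Cmp D W Z Y g q) y = \<one>\<^bsub>grp F W\<^esub>"
    using x(2) xg by (simp add: act_Cmp)
  then obtain l where "l \<in> Mor D W X" "Cmp D W Z Y g q = Cmp D W X Y m l"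
    using presentsD(3)[OF pr, of W "Cmp D W Z Y g q"] by auto
  then obtain h where "h \<in> Mor D Z X" "g = Cmp D Z X Y m h"
    using factors_through_inflation[OF m q g] by blast
  thus ?thesis
    using presentsD(3)[OF pr, of Z g] xg by auto
qed

lemma nat_trans_one:
  assumes "F \<in> adm_functors D" "G \<in> adm_functors D" "\<alpha> \<in> nat_trans D F G" "X \<in> Obj D"
  shows "\<alpha> X \<one>\<^bsub>grp F X\<^esub> = \<one>\<^bsub>grp G X\<^esub>"
  using nat_transD(1)[OF assms(3,4)] assms adm_additive_functor additive_functor.grp_group
  by (metis hom_one)

lemma effaced_nat_trans:
  assumes "F \<in> adm_functors D" "G \<in> adm_functors D" "\<alpha> \<in> nat_trans D F G"
    and "Z \<in> Obj D" "x \<in> carrier (grp F Z)" "effaced D F Z x"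
  shows "effaced D G Z (\<alpha> Z x)"
proof -
  obtain W q where q: "deflation D W Z q" and "act F W Z q x = \<one>\<^bsub>grp F W\<^esub>"
    using assms(6) by (auto simp: effaced_def)
  hence "act G W Z q (\<alpha> Z x) = \<one>\<^bsub>grp G W\<^esub>"
    using nat_transD(3)[OF assms(3), of W Z q x] nat_trans_one[OF assms(1-3)] deflationD[OF q] assms(5)
    by simp
  thus ?thesis
    using q by (auto simp: effaced_def)
qed

text \<open>Every value of a transformation is the image of an effaced element, hence effaced, and
  effaced elements of \<open>F\<close> are zero.\<close>

lemma nat_trans_eff_inf:
  assumes T: "T \<in> eff D" and F: "F \<in> inf_functors D"
  shows "nat_trans D T F = {Zero (mod_adm D) T F}"
proof -
  interpret T: additive_functor D T
    by (rule adm_additive_functor[OF eff_adm[OF T]])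
  interpret F: additive_functor D F
    by (rule adm_additive_functor[OF inf_adm[OF F]])
  have zero: "Zero (mod_adm D) T F \<in> nat_trans D T F"
    by (auto simp: nat_trans_def hom_def group.is_monoid monoid.m_closed monoid.one_closed monoid.l_one)
  have "\<alpha> = Zero (mod_adm D) T F" if \<alpha>: "\<alpha> \<in> nat_trans D T F" for \<alpha>
  proof (rule nat_trans_eqI[OF \<alpha> zero])
    fix X x assume X: "X \<in> Obj D" "x \<in> carrier (grp T X)"
    obtain W q where "deflation D W X q" "act F W X q (\<alpha> X x) = \<one>\<^bsub>grp F W\<^esub>"
      using effaced_nat_trans[OF eff_adm[OF T] inf_adm[OF F] \<alpha> X eff_effaced[OF T X]]
      by (auto simp: effaced_def)
    thus "\<alpha> X x = Zero (mod_adm D) T F X x"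
      using inf_separated[OF F, of W X q "\<alpha> X x"] nat_transD(2)[OF \<alpha>] X by simp
  qed
  thus ?thesis
    using zero by blast
qed

lemma torsion_sequence:
  assumes M: "M \<in> adm_functors D"
  shows "\<exists>T\<in>eff D. \<exists>F\<in>inf_functors D. \<exists>i p. Conf (mod_adm D) T M F i p"
proof -
  interpret additive_functor D M
    by (rule adm_additive_functor[OF M])
  obtain X I Y p m y where p: "deflation D X I p" and m: "inflation D I Y m"
    and pr: "presents D X Y (Cmp D X I Y m p) M y"
    using adm_presentation[OF M] .
  note [simp] = deflationD[OF p] inflationD[OF m] presentsD(1)[OF pr]
  define S where "S = generated D M I (act M I Y m y)"
  have S: "subpresheaf D M S"
    unfolding S_def by (rule generated_subpresheaf) auto
  interpret T: additive_functor D "restrict_presheaf M S"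
    by unfold_locales (rule additive_restrict_presheaf[OF S])
  interpret Q: additive_functor D "quot_presheaf M S"
    by unfold_locales (rule additive_quot_presheaf[OF S])
  \<comment> \<open>Since \<open>m\<close> is monic, m g factors through m p exactly when
    \<open>g\<close> factors through \<open>p\<close>.\<close>
  have "presents D X I p (restrict_presheaf M S) (act M I Y m y)"
    unfolding S_def
  proof (rule presents_generated)
    fix Z g assume Z [simp]: "Z \<in> Obj D" "g \<in> Mor D Z I"
    have "act M Z I g (act M I Y m y) = \<one>\<^bsub>grp M Z\<^esub> \<longleftrightarrow>
        (\<exists>h\<in>Mor D Z X. Cmp D Z I Y m g = Cmp D Z X Y (Cmp D X I Y m p) h)"
      using presentsD(3)[OF pr, of Z "Cmp D Z I Y m g"] by (simp add: act_Cmp)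
    also have "\<dots> \<longleftrightarrow> (\<exists>h\<in>Mor D Z X. g = Cmp D Z X I p h)"
    proof (intro bex_cong refl)
      fix h assume "h \<in> Mor D Z X"
      thus "Cmp D Z I Y m g = Cmp D Z X Y (Cmp D X I Y m p) h \<longleftrightarrow> g = Cmp D Z X I p h"
        using inflation_mono[OF m, of Z g "Cmp D Z X I p h"] Cmp_assoc[of Z X I Y h p m] by auto
    qed
    finally show "act M Z I g (act M I Y m y) = \<one>\<^bsub>grp M Z\<^esub> \<longleftrightarrow> (\<exists>h\<in>Mor D Z X. g = Cmp D Z X I p h)" .
  qed simp_all
  hence T: "restrict_presheaf M S \<in> eff D"
    by (rule T.effI[OF p])
  \<comment> \<open>Dividing out F(m)(y) adds the maps through \<open>m\<close> to those through m
    p. The latter contribute nothing new, because m k + m p l = m (k + p l).\<close>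
  have "presents D I Y m (quot_presheaf M S) (coset_rep (grp M Y) (S Y) y)"
    unfolding S_def
  proof (rule presents_quot_generated[OF pr])
    fix Z h assume Z [simp]: "Z \<in> Obj D" "h \<in> Mor D Z Y"
    show "(\<exists>w\<in>Mor D Z I. h = Cmp D Z I Y m w) \<longleftrightarrow> (\<exists>k\<in>Mor D Z I. \<exists>l\<in>Mor D Z X.
      h = Cmp D Z I Y m k \<otimes>\<^bsub>Hom D Z Y\<^esub> Cmp D Z X Y (Cmp D X I Y m p) l)"
    proof safe
      fix w assume w: "w \<in> Mor D Z I" "h = Cmp D Z I Y m w"
      thus "\<exists>k\<in>Mor D Z I. \<exists>l\<in>Mor D Z X.
          Cmp D Z I Y m w = Cmp D Z I Y m k \<otimes>\<^bsub>Hom D Z Y\<^esub> Cmp D Z X Y (Cmp D X I Y m p) l"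
        by (intro bexI[of _ w] bexI[of _ "Zero D Z X"]) (simp_all add: group.is_monoid monoid.r_one)
    next
      fix k l assume kl: "k \<in> Mor D Z I" "l \<in> Mor D Z X"
      thus "\<exists>w\<in>Mor D Z I.
          Cmp D Z I Y m k \<otimes>\<^bsub>Hom D Z Y\<^esub> Cmp D Z X Y (Cmp D X I Y m p) l = Cmp D Z I Y m w"
        using Cmp_assoc[of Z X I Y l p m]
        by (intro bexI[of _ "k \<otimes>\<^bsub>Hom D Z I\<^esub> Cmp D Z X I p l"]) (simp_all add: Cmp_add_right)
    qed
  qed simp_all
  hence Q: "quot_presheaf M S \<in> inf_functors D"
    by (rule Q.inf_functorsI[OF m])
  show ?thesis
    using T Q M eff_adm[OF T] inf_adm[OF Q] Conf_sub_quot[OF S]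
    by (intro bexI[OF _ T] bexI[OF _ Q]) auto
qed

section \<open>Kernels, images and cokernels of morphisms with effaced values\<close>

lemma Conf_kernel_image:
  assumes F: "additive_presheaf D F" and G: "additive_presheaf D G" and \<alpha>: "\<alpha> \<in> nat_trans D F G"
    and S: "subpresheaf D G S"
    and im: "\<And>X. X \<in> Obj D \<Longrightarrow> \<alpha> X ` carrier (grp F X) = S X"
  defines "K \<equiv> \<lambda>X. kernel (grp F X) (grp G X) (\<alpha> X)"
  shows "subpresheaf D F K"
    and "Conf (Mod_cat D) (restrict_presheaf F K) F (restrict_presheaf G S) (\<lambda>X\<in>Obj D. \<lambda>x\<in>K X. x) \<alpha>"
proof -
  interpret F: additive_functor D F
    by unfold_locales (rule F)
  interpret G: additive_functor D G
    by unfold_locales (rule G)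
  have gh: "group_hom (grp F X) (grp G X) (\<alpha> X)" if "X \<in> Obj D" for X
    using nat_transD(1)[OF \<alpha> that] that by (simp add: group_hom_def group_hom_axioms_def)
  show K: "subpresheaf D F K"
    unfolding subpresheaf_def
    using group_hom.subgroup_kernel[OF gh] nat_transD(3)[OF \<alpha>] by (simp add: K_def kernel_def)
  have incl: "(\<lambda>X\<in>Obj D. \<lambda>x\<in>K X. x) \<in> nat_trans D (restrict_presheaf F K) F"
    using F.Conf_sub_quot[OF K] by (simp add: Mod_cat_def)
  \<comment> \<open>The same function serves for the smaller codomain, since only its values matter
    and these lie in \<open>S\<close>.\<close>
  have \<alpha>': "\<alpha> \<in> nat_trans D F (restrict_presheaf G S)"
    using \<alpha> im by (auto simp: nat_trans_def hom_def)
  show "Conf (Mod_cat D) (restrict_presheaf F K) F (restrict_presheaf G S) (\<lambda>X\<in>Obj D. \<lambda>x\<in>K X. x) \<alpha>"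
    using incl \<alpha>' F F.additive_restrict_presheaf[OF K] G.additive_restrict_presheaf[OF S]
    by (auto simp: Mod_cat_def pointwise_inj_def pointwise_surj_def exact_at_def inj_on_def
        K_def kernel_def im)
qed

text \<open>As \<open>y\<close> generates \<open>F\<close>, naturality makes its image under
  \<alpha> generate the image of \<alpha>.\<close>

lemma nat_trans_image_generated:
  assumes \<alpha>: "\<alpha> \<in> nat_trans D F G" and pr: "presents D X Y f F y" and "Y \<in> Obj D" "Z \<in> Obj D"
    and F: "F \<in> adm_functors D"
  shows "\<alpha> Z ` carrier (grp F Z) = generated D G Y (\<alpha> Y y) Z"
proof -
  interpret additive_functor D F
    by (rule adm_additive_functor[OF F])
  note [simp] = presentsD(1)[OF pr] assms(3,4)
  have "carrier (grp F Z) = (\<lambda>g. act F Z Y g y) ` Mor D Z Y"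
    using presentsD(2)[OF pr assms(4)] by (auto simp: image_iff)
  thus ?thesis
    using nat_transD(3)[OF \<alpha>] by (simp add: generated_def image_image)
qed

text \<open>Covers both admissibility axioms at once, since values of \<alpha> are effaced as soon
  as its source or its target is effaceable. The image, cokernel and kernel are treated in this
  order.\<close>

lemma admissible_effaced_image:
  assumes F: "F \<in> adm_functors D" and G: "G \<in> adm_functors D" and \<alpha>: "\<alpha> \<in> nat_trans D F G"
    and eff: "\<And>Z x. \<lbrakk>Z \<in> Obj D; x \<in> carrier (grp F Z)\<rbrakk> \<Longrightarrow> effaced D G Z (\<alpha> Z x)"
  shows "\<exists>I\<in>eff D. admissible_with_image (mod_adm D) I F G \<alpha>"
proof -
  interpret F: additive_functor D F
    by (rule adm_additive_functor[OF F])
  interpret G: additive_functor D G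
    by (rule adm_additive_functor[OF G])
  obtain X I Y p m y where p: "deflation D X I p" and m: "inflation D I Y m"
    and pr: "presents D X Y (Cmp D X I Y m p) F y"
    using F.adm_presentation[OF F] .
  obtain X' I' Y' p' m' y' where p': "deflation D X' I' p'" and m': "inflation D I' Y' m'"
    and pr': "presents D X' Y' (Cmp D X' I' Y' m' p') G y'"
    using G.adm_presentation[OF G] .
  note [simp] = deflationD[OF p] inflationD[OF m] F.presentsD(1)[OF pr]
    deflationD[OF p'] inflationD[OF m'] G.presentsD(1)[OF pr']
  define t where "t = \<alpha> Y y"
  have t [simp]: "t \<in> carrier (grp G Y)"
    using nat_transD(2)[OF \<alpha>] by (simp add: t_def)
  have t_eff: "effaced D G Y t"
    using eff by (simp add: t_def)
  have \<alpha>_act: "\<alpha> Z (act F Z Y h y) = act G Z Y h t" if "Z \<in> Obj D" "h \<in> Mor D Z Y" for Z h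
    using nat_transD(3)[OF \<alpha>] that by (simp add: t_def)
  obtain W w where w: "deflation D W Y w" and ann: "\<And>A h. \<lbrakk>A \<in> Obj D; h \<in> Mor D A Y\<rbrakk> \<Longrightarrow>
      act G A Y h t = \<one>\<^bsub>grp G A\<^esub> \<longleftrightarrow> (\<exists>k\<in>Mor D A W. h = Cmp D A W Y w k)"
    using G.effaced_annihilator[OF G _ t t_eff] by auto
  note [simp] = deflationD[OF w]

  define S where "S = generated D G Y t"
  have S: "subpresheaf D G S"
    unfolding S_def by (rule G.generated_subpresheaf) auto
  interpret GS: additive_functor D "restrict_presheaf G S"
    by unfold_locales (rule G.additive_restrict_presheaf[OF S])
  interpret GQ: additive_functor D "quot_presheaf G S"
    by unfold_locales (rule G.additive_quot_presheaf[OF S])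
  have "presents D W Y w (restrict_presheaf G S) t"
    unfolding S_def by (rule G.presents_generated[OF _ t ann]) auto
  hence GS: "restrict_presheaf G S \<in> eff D"
    by (rule GS.effI[OF w])

  obtain g where g [simp]: "g \<in> Mor D Y I'" and tg: "t = act G Y Y' (Cmp D Y I' Y' m' g) y'"
    using G.effaced_factors[OF p' m' pr' _ t t_eff] by auto
  \<comment> \<open>\<open>d\<close> is the map (g, p') from the direct sum of \<open>Y\<close> and
    \<open>X'\<close> to \<open>I'\<close>, a deflation because \<open>p'\<close> is one.\<close>
  obtain P d where d: "deflation D P I' d" and df: "\<And>A h. \<lbrakk>A \<in> Obj D; h \<in> Mor D A I'\<rbrakk> \<Longrightarrow>
      (\<exists>u\<in>Mor D A P. h = Cmp D A P I' d u) \<longleftrightarrow>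
      (\<exists>k\<in>Mor D A Y. \<exists>l\<in>Mor D A X'.
        h = Cmp D A Y I' g k \<otimes>\<^bsub>Hom D A I'\<^esub> Cmp D A X' I' p' l)"
    using deflation_sum[OF p' inflationD(2)[OF m] g] by blast
  note [simp] = deflationD[OF d]
  have "presents D P Y' (Cmp D P I' Y' m' d) (quot_presheaf G S) (coset_rep (grp G Y') (S Y') y')"
    unfolding S_def tg
  proof (rule G.presents_quot_generated[OF pr'])
    fix Z h assume Z [simp]: "Z \<in> Obj D" "h \<in> Mor D Z Y'"
    \<comment> \<open>Taking \<open>m'\<close> out of the sum shows that the maps to be divided out
      are those that factor through m' d, an admissible morphism.\<close>
    have sum: "Cmp D Z Y Y' (Cmp D Y I' Y' m' g) k \<otimes>\<^bsub>Hom D Z Y'\<^esub>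
        Cmp D Z X' Y' (Cmp D X' I' Y' m' p') l =
        Cmp D Z I' Y' m' (Cmp D Z Y I' g k \<otimes>\<^bsub>Hom D Z I'\<^esub> Cmp D Z X' I' p' l)"
      if "k \<in> Mor D Z Y" "l \<in> Mor D Z X'" for k l
      using that by (simp add: Cmp_add_right Cmp_assoc[of Z _ I' Y'])
    show "(\<exists>u\<in>Mor D Z P. h = Cmp D Z P Y' (Cmp D P I' Y' m' d) u) \<longleftrightarrow>
      (\<exists>k\<in>Mor D Z Y. \<exists>l\<in>Mor D Z X'. h = Cmp D Z Y Y' (Cmp D Y I' Y' m' g) k \<otimes>\<^bsub>Hom D Z Y'\<^esub>
        Cmp D Z X' Y' (Cmp D X' I' Y' m' p') l)"
    proof
      assume "\<exists>u\<in>Mor D Z P. h = Cmp D Z P Y' (Cmp D P I' Y' m' d) u"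
      then obtain u where u: "u \<in> Mor D Z P" "h = Cmp D Z I' Y' m' (Cmp D Z P I' d u)"
        using Cmp_assoc[of Z P I' Y' _ d m'] by auto
      obtain k l where "k \<in> Mor D Z Y" "l \<in> Mor D Z X'"
        "Cmp D Z P I' d u = Cmp D Z Y I' g k \<otimes>\<^bsub>Hom D Z I'\<^esub> Cmp D Z X' I' p' l"
        using df[of Z "Cmp D Z P I' d u"] u by auto
      thus "\<exists>k\<in>Mor D Z Y. \<exists>l\<in>Mor D Z X'. h = Cmp D Z Y Y' (Cmp D Y I' Y' m' g) k \<otimes>\<^bsub>Hom D Z Y'\<^esub>
          Cmp D Z X' Y' (Cmp D X' I' Y' m' p') l"
        using sum u by metis
    next
      assume "\<exists>k\<in>Mor D Z Y. \<exists>l\<in>Mor D Z X'. h = Cmp D Z Y Y' (Cmp D Y I' Y' m' g) k \<otimes>\<^bsub>Hom D Z Y'\<^esub>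
          Cmp D Z X' Y' (Cmp D X' I' Y' m' p') l"
      then obtain k l where kl: "k \<in> Mor D Z Y" "l \<in> Mor D Z X'"
        "h = Cmp D Z I' Y' m' (Cmp D Z Y I' g k \<otimes>\<^bsub>Hom D Z I'\<^esub> Cmp D Z X' I' p' l)"
        using sum by metis
      have "\<exists>u\<in>Mor D Z P. Cmp D Z Y I' g k \<otimes>\<^bsub>Hom D Z I'\<^esub> Cmp D Z X' I' p' l = Cmp D Z P I' d u"
        using df[of Z "Cmp D Z Y I' g k \<otimes>\<^bsub>Hom D Z I'\<^esub> Cmp D Z X' I' p' l"] kl by auto
      then obtain u where "u \<in> Mor D Z P"
        "Cmp D Z Y I' g k \<otimes>\<^bsub>Hom D Z I'\<^esub> Cmp D Z X' I' p' l = Cmp D Z P I' d u"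
        by blast
      thus "\<exists>u\<in>Mor D Z P. h = Cmp D Z P Y' (Cmp D P I' Y' m' d) u"
        using kl(3) Cmp_assoc[of Z P I' Y' u d m'] by auto
    qed
  qed simp_all
  hence GQ: "quot_presheaf G S \<in> adm_functors D"
    by (rule GQ.adm_functorsI[OF d m'])

  define K where "K = (\<lambda>Z. kernel (grp F Z) (grp G Z) (\<alpha> Z))"
  have im: "\<alpha> Z ` carrier (grp F Z) = S Z" if "Z \<in> Obj D" for Z
    using nat_trans_image_generated[OF \<alpha> pr _ that F] by (simp add: S_def t_def)
  have K: "subpresheaf D F K"
    and cKS: "Conf (Mod_cat D) (restrict_presheaf F K) F (restrict_presheaf G S) (\<lambda>X\<in>Obj D. \<lambda>x\<in>K X. x) \<alpha>"
    using Conf_kernel_image[OF F.presheaf G.presheaf \<alpha> S im] by (simp_all add: K_def)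
  interpret FK: additive_functor D "restrict_presheaf F K"
    by unfold_locales (rule F.additive_restrict_presheaf[OF K])
  \<comment> \<open>F(h)(y) is in the kernel iff \<open>h\<close> kills \<open>t\<close>, that is,
    iff \<open>h\<close> factors through \<open>w\<close>. Hence F(w)(y) generates the
    kernel.\<close>
  have K_iff: "act F Z Y h y \<in> K Z \<longleftrightarrow> (\<exists>k\<in>Mor D Z W. h = Cmp D Z W Y w k)"
    if "Z \<in> Obj D" "h \<in> Mor D Z Y" for Z h
    using ann[OF that] that by (simp add: K_def kernel_def \<alpha>_act)
  obtain V J v j where v: "deflation D V J v" and j: "inflation D J W j"
    and jv: "\<And>A h. \<lbrakk>A \<in> Obj D; h \<in> Mor D A W\<rbrakk> \<Longrightarrow>
      (\<exists>k\<in>Mor D A V. h = Cmp D A V W (Cmp D V J W j v) k) \<longleftrightarrow>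
      (\<exists>l\<in>Mor D A X. Cmp D A W Y w h = Cmp D A X Y (Cmp D X I Y m p) l)"
    using admissible_factor_pullback[OF p m w] by blast
  note [simp] = deflationD[OF v] inflationD[OF j]
  have "presents D V W (Cmp D V J W j v) (restrict_presheaf F K) (act F W Y w y)"
    unfolding presents_def
  proof (intro conjI ballI)
    have "\<exists>k\<in>Mor D W W. w = Cmp D W W Y w k"
      by (intro bexI[of _ "Idn D W"]) (simp_all add: Cmp_Idn)
    thus "act F W Y w y \<in> carrier (grp (restrict_presheaf F K) W)"
      using K_iff by simp
  next
    fix Z x assume Z: "Z \<in> Obj D" "x \<in> carrier (grp (restrict_presheaf F K) Z)"
    hence "x \<in> carrier (grp F Z)"
      using F.subpresheaf_carrier[OF K] by simp
    then obtain h where h: "h \<in> Mor D Z Y" "x = act F Z Y h y"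
      using F.presentsD(2)[OF pr Z(1)] by blast
    then obtain k where "k \<in> Mor D Z W" "h = Cmp D Z W Y w k"
      using K_iff[of Z h] Z by auto
    thus "\<exists>k\<in>Mor D Z W. x = act (restrict_presheaf F K) Z W k (act F W Y w y)"
      using h Z by (auto simp: F.act_Cmp)
  next
    fix Z h assume Z: "Z \<in> Obj D" "h \<in> Mor D Z W"
    have "act F Z W h (act F W Y w y) = \<one>\<^bsub>grp F Z\<^esub> \<longleftrightarrow>
        (\<exists>l\<in>Mor D Z X. Cmp D Z W Y w h = Cmp D Z X Y (Cmp D X I Y m p) l)"
      using F.presentsD(3)[OF pr, of Z "Cmp D Z W Y w h"] Z by (simp add: F.act_Cmp)
    thus "act (restrict_presheaf F K) Z W h (act F W Y w y) = \<one>\<^bsub>grp (restrict_presheaf F K) Z\<^esub> \<longleftrightarrow>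
        (\<exists>k\<in>Mor D Z V. h = Cmp D Z V W (Cmp D V J W j v) k)"
      using jv[OF Z] by simp
  qed
  hence FK: "restrict_presheaf F K \<in> adm_functors D"
    by (rule FK.adm_functorsI[OF v j])

  have "deflation (mod_adm D) F (restrict_presheaf G S) \<alpha>"
    using cKS FK F eff_adm[OF GS] by (auto simp: deflation_def)
  moreover have "inflation (mod_adm D) (restrict_presheaf G S) G (\<lambda>X\<in>Obj D. \<lambda>x\<in>S X. x)"
    using G.Conf_sub_quot[OF S] G GQ eff_adm[OF GS] 
    unfolding inflation_def by (intro exI) (rule mod_adm_simps(6)[THEN iffD2], blast)
  \<comment> \<open>Including the image into \<open>G\<close> changes no value; extensionality turns
    this into equality of functions.\<close>
  moreover have "\<alpha> = Cmp (mod_adm D) F (restrict_presheaf G S) G (\<lambda>X\<in>Obj D. \<lambda>x\<in>S X. x) \<alpha>"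
  proof (rule extensionalityI[of _ "Obj D"])
    fix Z assume Z: "Z \<in> Obj D"
    show "\<alpha> Z = Cmp (mod_adm D) F (restrict_presheaf G S) G (\<lambda>X\<in>Obj D. \<lambda>x\<in>S X. x) \<alpha> Z"
      by (rule extensionalityI[of _ "carrier (grp F Z)"])
        (use Z \<alpha> im[OF Z] in \<open>auto simp: nat_trans_def compose_def\<close>)
  qed (use \<alpha> in \<open>auto simp: nat_trans_def\<close>)
  ultimately show ?thesis
    using GS unfolding admissible_with_image_def by blast
qed

section \<open>Closure properties and admissibility axioms for effaceable functors\<close>

lemma is_iso_mod_admD:
  assumes "is_iso (mod_adm D) F G \<alpha>"
  obtains \<beta> where "\<alpha> \<in> nat_trans D F G" "\<beta> \<in> nat_trans D G F"
    "\<And>X x. \<lbrakk>X \<in> Obj D; x \<in> carrier (grp G X)\<rbrakk> \<Longrightarrow> \<alpha> X (\<beta> X x) = x"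
proof -
  obtain \<beta> where \<beta>: "\<alpha> \<in> nat_trans D F G" "\<beta> \<in> nat_trans D G F"
    and eq: "(\<lambda>X\<in>Obj D. compose (carrier (grp G X)) (\<alpha> X) (\<beta> X)) = (\<lambda>X\<in>Obj D. \<lambda>x\<in>carrier (grp G X). x)"
    using assms by (auto simp: is_iso_def)
  have "\<alpha> X (\<beta> X x) = x" if "X \<in> Obj D" "x \<in> carrier (grp G X)" for X x
    using fun_cong[OF fun_cong[OF eq, of X], of x] that by (simp add: compose_def)
  thus ?thesis
    using that \<beta> by blast
qed

text \<open>Every element of \<open>G\<close> has the form \<alpha>(\<beta>(x)), and \<alpha>
  carries the effaced element \<beta>(x) to an effaced one.\<close>

lemma eff_iso_closed: "iso_closed_subcategory (mod_adm D) (eff D)"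
  unfolding iso_closed_subcategory_def
proof (intro conjI ballI impI)
  show "eff D \<subseteq> Obj (mod_adm D)"
    using eff_adm by auto
next
  fix F G :: "('a, 'b, 'c) presheaf"
  assume F: "F \<in> eff D" and "G \<in> Obj (mod_adm D)" and "\<exists>\<alpha>. is_iso (mod_adm D) F G \<alpha>"
  then obtain \<alpha> \<beta> where G: "G \<in> adm_functors D"
    and \<alpha>: "\<alpha> \<in> nat_trans D F G" and \<beta>: "\<beta> \<in> nat_trans D G F"
    and inv: "\<And>X x. \<lbrakk>X \<in> Obj D; x \<in> carrier (grp G X)\<rbrakk> \<Longrightarrow> \<alpha> X (\<beta> X x) = x"
    using is_iso_mod_admD by (metis mod_adm_simps(1))
  show "G \<in> eff D"
  proof (rule additive_functor.effI_effaced[OF adm_additive_functor[OF G] G])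
    fix Z x assume Z: "Z \<in> Obj D" "x \<in> carrier (grp G Z)"
    thus "effaced D G Z x"
      using effaced_nat_trans[OF eff_adm[OF F] G \<alpha> Z(1) _ eff_effaced[OF F Z(1)], of "\<beta> Z x"]
        nat_transD(2)[OF \<beta> Z] inv by simp
  qed
qed

text \<open>If a deflation kills \<open>x\<close>, it kills \<beta>(x), which is then zero by
  separatedness of \<open>F\<close>; so x = \<alpha>(\<beta>(x)) is zero too.\<close>

lemma inf_iso_closed: "iso_closed_subcategory (mod_adm D) (inf_functors D)"
  unfolding iso_closed_subcategory_def
proof (intro conjI ballI impI)
  show "inf_functors D \<subseteq> Obj (mod_adm D)"
    using inf_adm by auto
next
  fix F G :: "('a, 'b, 'c) presheaf"
  assume F: "F \<in> inf_functors D" and "G \<in> Obj (mod_adm D)" and "\<exists>\<alpha>. is_iso (mod_adm D) F G \<alpha>"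
  then obtain \<alpha> \<beta> where G: "G \<in> adm_functors D"
    and \<alpha>: "\<alpha> \<in> nat_trans D F G" and \<beta>: "\<beta> \<in> nat_trans D G F"
    and inv: "\<And>X x. \<lbrakk>X \<in> Obj D; x \<in> carrier (grp G X)\<rbrakk> \<Longrightarrow> \<alpha> X (\<beta> X x) = x"
    using is_iso_mod_admD by (metis mod_adm_simps(1))
  show "G \<in> inf_functors D"
  proof (rule additive_functor.inf_functorsI_separated[OF adm_additive_functor[OF G] G])
    fix W Z q x
    assume q: "deflation D W Z q" and x: "x \<in> carrier (grp G Z)" "act G W Z q x = \<one>\<^bsub>grp G W\<^esub>"
    note qD = deflationD[OF q]
    have "act F W Z q (\<beta> Z x) = \<one>\<^bsub>grp F W\<^esub>"
      using nat_transD(3)[OF \<beta> qD(1,2,3) x(1)] x(2) nat_trans_one[OF G inf_adm[OF F] \<beta> qD(1)] by simp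
    hence "\<beta> Z x = \<one>\<^bsub>grp F Z\<^esub>"
      using inf_separated[OF F q] nat_transD(2)[OF \<beta> qD(2) x(1)] by blast
    thus "x = \<one>\<^bsub>grp G Z\<^esub>"
      using inv[OF qD(2) x(1)] nat_trans_one[OF inf_adm[OF F] G \<alpha> qD(2)] by simp
  qed
qed

text \<open>The zero functor is presented by the identity of any object, which is a
  deflation.\<close>

lemma eff_nonempty: "(eff D :: ('a, 'b, 'u) presheaf set) \<noteq> {}"
proof -
  obtain X where X: "X \<in> Obj D"
    using ex_zero_object by (auto simp: zero_object_def)
  \<comment> \<open>The value type is arbitrary, so \<open>undefined\<close> is taken as the single
    element of every group.\<close>
  define F :: "('a, 'b, 'u) presheaf" where
    "F = \<lparr>grp = (\<lambda>_. \<lparr>carrier = {undefined}, mult = (\<lambda>_ _. undefined), one = undefined\<rparr>),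
       act = (\<lambda>_ _ _ _. undefined)\<rparr>"
  interpret additive_functor D F
    by unfold_locales
      (auto simp: F_def additive_presheaf_def hom_def intro!: comm_groupI)
  have "presents D X X (Idn D X) F undefined"
    unfolding presents_def
  proof (intro conjI ballI)
    fix Z x assume "Z \<in> Obj D" "x \<in> carrier (grp F Z)"
    thus "\<exists>g\<in>Mor D Z X. x = act F Z X g undefined"
      using X by (intro bexI[of _ "Zero D Z X"]) (simp_all add: F_def)
  next
    fix Z g assume "Z \<in> Obj D" "g \<in> Mor D Z X"
    thus "act F Z X g undefined = \<one>\<^bsub>grp F Z\<^esub> \<longleftrightarrow> (\<exists>h\<in>Mor D Z X. g = Cmp D Z X X (Idn D X) h)"
      using X by (auto simp: F_def Idn_Cmp)
  qed (simp add: F_def)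
  thus ?thesis
    using effI[OF deflation_Idn[OF X]] by blast
qed

text \<open>Effacement of all elements passes to subfunctors by injectivity of \<alpha> and to
  quotients by surjectivity of \<beta>. For extensions, one deflation moves an element of
  \<open>G\<close> into the image of \<open>F\<close>, a second one kills it there, and their
  composite is a deflation.\<close>

lemma eff_Conf_iff:
  assumes c: "Conf (mod_adm D) F G H \<alpha> \<beta>"
  shows "G \<in> eff D \<longleftrightarrow> F \<in> eff D \<and> H \<in> eff D"
proof -
  have adm: "F \<in> adm_functors D" "G \<in> adm_functors D" "H \<in> adm_functors D"
    and \<alpha>: "\<alpha> \<in> nat_trans D F G" and \<beta>: "\<beta> \<in> nat_trans D G H"
    and inj: "\<And>X. X \<in> Obj D \<Longrightarrow> inj_on (\<alpha> X) (carrier (grp F X))"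
    and ex: "\<And>X. X \<in> Obj D \<Longrightarrow> \<alpha> X ` carrier (grp F X) = kernel (grp G X) (grp H X) (\<beta> X)"
    and surj: "\<And>X. X \<in> Obj D \<Longrightarrow> \<beta> X ` carrier (grp G X) = carrier (grp H X)"
    using c by (auto simp: Mod_cat_def pointwise_inj_def exact_at_def pointwise_surj_def)
  interpret F: additive_functor D F
    by (rule adm_additive_functor[OF adm(1)])
  interpret G: additive_functor D G
    by (rule adm_additive_functor[OF adm(2)])
  interpret H: additive_functor D H
    by (rule adm_additive_functor[OF adm(3)])
  show ?thesis
  proof safe
    assume G: "G \<in> eff D"
    show "F \<in> eff D"
    proof (rule F.effI_effaced[OF adm(1)])
      fix Z x assume Z: "Z \<in> Obj D" "x \<in> carrier (grp F Z)"
      obtain W q where q: "deflation D W Z q" and "act G W Z q (\<alpha> Z x) = \<one>\<^bsub>grp G W\<^esub>"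
        using eff_effaced[OF G Z(1) nat_transD(2)[OF \<alpha> Z]] by (auto simp: effaced_def)
      moreover note qD = deflationD[OF q]
      ultimately have "\<alpha> W (act F W Z q x) = \<alpha> W \<one>\<^bsub>grp F W\<^esub>"
        using nat_transD(3)[OF \<alpha>] nat_trans_one[OF adm(1,2) \<alpha>] Z by simp
      hence "act F W Z q x = \<one>\<^bsub>grp F W\<^esub>"
        using inj[OF qD(1)] qD Z by (simp add: inj_on_eq_iff group.is_monoid monoid.one_closed)
      thus "effaced D F Z x"
        using q by (auto simp: effaced_def)
    qed
    show "H \<in> eff D"
    proof (rule H.effI_effaced[OF adm(3)])
      fix Z x assume Z: "Z \<in> Obj D" "x \<in> carrier (grp H Z)"
      then obtain a where "a \<in> carrier (grp G Z)" "x = \<beta> Z a"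
        using surj by blast
      thus "effaced D H Z x"
        using effaced_nat_trans[OF adm(2,3) \<beta> Z(1)] eff_effaced[OF G Z(1)] by blast
    qed
  next
    assume F: "F \<in> eff D" and H: "H \<in> eff D"
    show "G \<in> eff D"
    proof (rule G.effI_effaced[OF adm(2)])
      fix Z x assume Z: "Z \<in> Obj D" "x \<in> carrier (grp G Z)"
      obtain W q where q: "deflation D W Z q" and "act H W Z q (\<beta> Z x) = \<one>\<^bsub>grp H W\<^esub>"
        using eff_effaced[OF H Z(1) nat_transD(2)[OF \<beta> Z]] by (auto simp: effaced_def)
      moreover note qD = deflationD[OF q]
      ultimately have "act G W Z q x \<in> kernel (grp G W) (grp H W) (\<beta> W)"
        using nat_transD(3)[OF \<beta>] Z by (simp add: kernel_def)
      then obtain a where a: "a \<in> carrier (grp F W)" "act G W Z q x = \<alpha> W a"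
        using ex[OF qD(1)] by blast
      obtain V r where r: "deflation D V W r" and "act G V W r (\<alpha> W a) = \<one>\<^bsub>grp G V\<^esub>"
        using effaced_nat_trans[OF adm(1,2) \<alpha> qD(1) a(1) eff_effaced[OF F qD(1) a(1)]]
        by (auto simp: effaced_def)
      hence "act G V Z (Cmp D V W Z q r) x = \<one>\<^bsub>grp G V\<^esub>"
        using a qD Z deflationD[OF r] by (simp add: G.act_Cmp)
      thus "effaced D G Z x"
        using deflation_Cmp[OF r q] by (auto simp: effaced_def)
    qed
  qed
qed

text \<open>All values of \<alpha> lie in the effaceable functor \<open>G\<close>, hence are
  effaced.\<close>

lemma admissible_into_eff: "admissible_into (mod_adm D) (eff D)"
  unfolding admissible_into_def
proof (intro ballI)
  fix F G :: "('a, 'b, 'c) presheaf" and \<alpha>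
  assume "F \<in> Obj (mod_adm D)" and G: "G \<in> eff D" and "\<alpha> \<in> Mor (mod_adm D) F G"
  hence "F \<in> adm_functors D" and \<alpha>: "\<alpha> \<in> nat_trans D F G"
    by simp_all
  thus "\<exists>I\<in>eff D. admissible_with_image (mod_adm D) I F G \<alpha>"
    using admissible_effaced_image eff_effaced[OF G] eff_adm[OF G] nat_transD(2)[OF \<alpha>] by blast
qed

text \<open>Here effacement comes from the source: naturality carries it along \<alpha>.\<close>

lemma admissible_out_of_eff: "admissible_out_of (mod_adm D) (eff D)"
  unfolding admissible_out_of_def
proof (intro ballI)
  fix F G :: "('a, 'b, 'c) presheaf" and \<alpha>
  assume F: "F \<in> eff D" and "G \<in> Obj (mod_adm D)" and "\<alpha> \<in> Mor (mod_adm D) F G"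
  hence G: "G \<in> adm_functors D" and \<alpha>: "\<alpha> \<in> nat_trans D F G"
    by simp_all
  show "\<exists>I\<in>eff D. admissible_with_image (mod_adm D) I F G \<alpha>"
  proof (rule admissible_effaced_image[OF eff_adm[OF F] G \<alpha>])
    fix Z x assume "Z \<in> Obj D" "x \<in> carrier (grp F Z)"
    thus "effaced D G Z (\<alpha> Z x)"
      by (intro effaced_nat_trans[OF eff_adm[OF F] G \<alpha>] eff_effaced[OF F])
  qed
qed

end

theorem proposition3p6:
  fixes E :: "('o, 'm) excat"
  assumes "exact_category E"
  shows "torsion_pair (mod_adm E :: (('o, 'm, 'u) presheaf, 'o \<Rightarrow> 'u \<Rightarrow> 'u) excat)
           (eff E) (inf_functors E) \<and>
         admissible_into (mod_adm E :: (('o, 'm, 'u) presheaf, 'o \<Rightarrow> 'u \<Rightarrow> 'u) excat) (eff E) \<and>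
         percolating (mod_adm E :: (('o, 'm, 'u) presheaf, 'o \<Rightarrow> 'u \<Rightarrow> 'u) excat) (eff E)"
proof -
  interpret exact_category E
    by (rule assms)
  have "torsion_pair (mod_adm E :: (('o, 'm, 'u) presheaf, 'o \<Rightarrow> 'u \<Rightarrow> 'u) excat)
      (eff E) (inf_functors E)"
    unfolding torsion_pair_def mod_adm_simps(1,2)
    by (intro conjI ballI eff_iso_closed inf_iso_closed nat_trans_eff_inf torsion_sequence)
  thus ?thesis
    unfolding percolating_def
    by (intro conjI allI impI eff_iso_closed eff_nonempty eff_Conf_iff
        admissible_into_eff admissible_out_of_eff)
qed

end
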